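(* $F(L)$ (with the usual addition and multiplication of formal Laurent series) is a field, and $\nu: F(L)^*\to L^n$ is a homomorphism from the multiplicative group $F(L)^*$ of $F(L)$ to the ordered abelian group $L^n$.
   Context: Ordered groups. An ordered abelian group is an abelian group $G=G_-\sqcup\{0\}\sqcup G_+$ such that $a\in G_-\Rightarrow -a\in G_+$ and $G_+$ is a semigroup; $a>b$ means $a-b\in G_+$ (a total order). A subgroup $H$ is isolated if $g_1>g_2>0$ and $g_1\in H$ imply $g_2\in H$. Isolated subgroups form a tower $G=H^k\supsetneq\dots\supsetneq H^0=\{0\}$ and $k$ is the rank of $G$. Flags of lattices. $L^n$ is an ordered abelian group of rank $n$ isomorphic to $\mathbb Z^n$, written multiplicatively (identity $1$; its elements are called monomials). $L^n=\hat L^n\supset\hat L^{n-1}\supset\dots\supset\hat L^0=L^0=\{1\}$ are its isolated subgroups, and $L^i\subset\hat L^i$ ($1\le i\le n-1$) are subgroups of full rank such that $L^n\supset L^{n-1}\supset\dots\supset L^0$ (a flag of lattices). A subscript $+$ denotes the set of positive elements. Put $H^0_+=\{1\}$, $H^k_+=L^k_+\setminus\hat L^{k-1}$ for $k\ge1$, and let $L=H^0_+\cup\dots\cup H^n_+$, a semigroup. Cones. $\hat{\mathcal C}$ is the set of all simple cones $\hat C=\{x_1^{k_1}\cdots x_n^{k_n}:k_i\in\mathbb Z_{\ge0}\}$ generated by a $\mathbb Z$-basis $(x_1,\dots,x_n)$ of $L^n$ such that for every $k=1,\dots,n$ exactly $k$ of the generators lie in $\hat L^k_+$; numbering them so that $x_i\in\hat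 L^i_+$ they are called the standard generators of $\hat C$. Laurent series. $T^n=\operatorname{Spec}\mathbb C[L^n]\cong(\mathbb C^* )^n$ is the torus on which elements of $L^n$ are monomial functions. $F(L)^*$ is the set of all nonzero formal infinite linear combinations $f=\sum_{p\in L^n}f_p\,p$ ($f_p\in\mathbb C$) such that (1) $f$ converges at at least one point of $T^n$; (2) there exist $\hat C\in\hat{\mathcal C}$ and $p_0\in L^n$ with $\{p: f_p\ne0\}\subset\hat C+p_0:=\{c\,p_0:c\in\hat C\}$. $F(L)=F(L)^*\sqcup\{0\}$. For $f\in F(L)^*$, $\nu(f)\in L^n$ is the smallest $p\in L^n$ with $f_p\neq0$ (it exists). *)

theory Defs
  imports "HOL-Analysis.Analysis" "HOL-Algebra.Product_Groups" "HOL-Algebra.Multiplicative_Group"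
begin

section \<open>Ordered abelian groups\<close>

record 'a ordered_group = "'a monoid" + pos :: "'a set"

definition grp_less :: "('a, 'b) ordered_group_scheme \<Rightarrow> 'a \<Rightarrow> 'a \<Rightarrow> bool" where
  "grp_less G b a \<longleftrightarrow> a \<otimes>\<^bsub>G\<^esub> inv\<^bsub>G\<^esub> b \<in> pos G"

text \<open>The set of negative elements is the complement of the positive elements and the identity.\<close>

locale ordered_abelian_group = comm_group G for G :: "('a, 'b) ordered_group_scheme" (structure) +
  assumes pos_subset: "pos G \<subseteq> carrier G"
    and one_not_pos: "\<one> \<notin> pos G"
    and pos_closed: "\<lbrakk>a \<in> pos G; b \<in> pos G\<rbrakk> \<Longrightarrow> a \<otimes> b \<in> pos G"
    and neg_inv_pos: "a \<in> carrier G - ({\<one>} \<union> pos G) \<Longrightarrow> inv a \<in> pos G"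

definition isolated_subgroup :: "('a, 'b) ordered_group_scheme \<Rightarrow> 'a set \<Rightarrow> bool" where
  "isolated_subgroup G H \<longleftrightarrow> subgroup H G \<and>
     (\<forall>g1 g2. g1 \<in> H \<longrightarrow> g2 \<in> pos G \<longrightarrow> grp_less G g2 g1 \<longrightarrow> g2 \<in> H)"

text \<open>
  The order rank of \<open>G\<close> is \<open>n\<close> if and only if there is a tower
  \<open>{\<one>} = H 0 \<subset> \<dots> \<subset> H n = carrier G\<close> as below; the values \<open>H 0, \<dots>, H n\<close> are then unique.
\<close>

definition isolated_tower ::
    "('a, 'b) ordered_group_scheme \<Rightarrow> nat \<Rightarrow> (nat \<Rightarrow> 'a set) \<Rightarrow> bool" where
  "isolated_tower G n H \<longleftrightarrow>
     H 0 = {\<one>\<^bsub>G\<^esub>} \<and> H n = carrier G \<and> (\<forall>i<n. H i \<subset> H (Suc i)) \<and>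
     {K. isolated_subgroup G K} = H ` {0..n}"


section \<open>Flags of lattices\<close>

definition Z_independent :: "('a, 'b) monoid_scheme \<Rightarrow> 'a set \<Rightarrow> bool" where
  "Z_independent G S \<longleftrightarrow> finite S \<and> S \<subseteq> carrier G \<and>
     (\<forall>k :: 'a \<Rightarrow> int. (\<Otimes>\<^bsub>G\<^esub>s\<in>S. s [^]\<^bsub>G\<^esub> k s) = \<one>\<^bsub>G\<^esub> \<longrightarrow> (\<forall>s\<in>S. k s = 0))"

definition has_Z_rank :: "('a, 'b) monoid_scheme \<Rightarrow> 'a set \<Rightarrow> nat \<Rightarrow> bool" where
  "has_Z_rank G H r \<longleftrightarrow>
     (\<exists>S\<subseteq>H. Z_independent G S \<and> card S = r) \<and>
     (\<forall>S\<subseteq>H. Z_independent G S \<longrightarrow> card S \<le> r)"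

definition full_rank_subgroup :: "('a, 'b) monoid_scheme \<Rightarrow> 'a set \<Rightarrow> 'a set \<Rightarrow> bool" where
  "full_rank_subgroup G H K \<longleftrightarrow>
     subgroup H G \<and> H \<subseteq> K \<and> (\<exists>r. has_Z_rank G H r \<and> has_Z_rank G K r)"

text \<open>
  Here \<open>G\<close> is the ordered group \<open>L\<^sup>n\<close>, \<open>Lhat\<close> its tower of isolated subgroups
  and \<open>L\<close> the flag.
\<close>

locale flag_of_lattices = ordered_abelian_group G
  for G :: "('a, 'b) ordered_group_scheme" (structure) +
  fixes n :: nat and Lhat :: "nat \<Rightarrow> 'a set" and L :: "nat \<Rightarrow> 'a set"
  assumes iso_Zn: "G \<cong> product_group {1..n} (\<lambda>_. integer_group)"
    and tower: "isolated_tower G n Lhat"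
    and L_top: "L n = carrier G"
    and L_bot: "L 0 = {\<one>}"
    and L_full_rank: "\<And>i. \<lbrakk>1 \<le> i; i < n\<rbrakk> \<Longrightarrow> full_rank_subgroup G (L i) (Lhat i)"
    and L_mono: "\<And>i. i < n \<Longrightarrow> L i \<subseteq> L (Suc i)"


section \<open>Simple cones\<close>

definition Z_basis :: "('a, 'b) monoid_scheme \<Rightarrow> nat \<Rightarrow> (nat \<Rightarrow> 'a) \<Rightarrow> bool" where
  "Z_basis G n x \<longleftrightarrow> x \<in> {1..n} \<rightarrow> carrier G \<and>
     bij_betw (\<lambda>k :: nat \<Rightarrow> int. \<Otimes>\<^bsub>G\<^esub>i\<in>{1..n}. x i [^]\<^bsub>G\<^esub> k i) ({1..n} \<rightarrow>\<^sub>E UNIV) (carrier G)"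

definition simple_cones ::
    "('a, 'b) ordered_group_scheme \<Rightarrow> nat \<Rightarrow> (nat \<Rightarrow> 'a set) \<Rightarrow> 'a set set" where
  "simple_cones G n Lhat =
     {C. \<exists>x. Z_basis G n x \<and>
             (\<forall>k\<in>{1..n}. card {i \<in> {1..n}. x i \<in> Lhat k \<inter> pos G} = k) \<and>
             C = {(\<Otimes>\<^bsub>G\<^esub>i\<in>{1..n}. x i [^]\<^bsub>G\<^esub> k i) |k :: nat \<Rightarrow> nat. True}}"


section \<open>Laurent series\<close>

text \<open>
  A formal infinite linear combination of elements of \<open>G\<close> is encoded by its coefficient function,
  which is required to vanish outside \<open>carrier G\<close>.
\<close>

type_synonym 'a series = "'a \<Rightarrow> complex"

definition series_support :: "'a series \<Rightarrow> 'a set" where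
  "series_support f = {p. f p \<noteq> 0}"

definition complex_units :: "complex monoid" where
  "complex_units = \<lparr>carrier = UNIV - {0}, monoid.mult = (*), one = 1\<rparr>"

text \<open>
  A point \<open>t\<close> of the torus \<open>Spec \<complex>[G]\<close> is identified with the homomorphism \<open>p \<mapsto> p(t)\<close> from \<open>G\<close> to
  the multiplicative group of the complex numbers. As \<open>G\<close> carries no preferred enumeration, the
  series is summed unconditionally, which for complex terms amounts to absolute convergence.
\<close>

definition torus_points :: "('a, 'b) monoid_scheme \<Rightarrow> ('a \<Rightarrow> complex) set" where
  "torus_points G = hom G complex_units"

definition series_converges_at ::
    "('a, 'b) monoid_scheme \<Rightarrow> 'a series \<Rightarrow> ('a \<Rightarrow> complex) \<Rightarrow> bool" where
  "series_converges_at G f t \<longleftrightarrow> (\<lambda>p. f p * t p) summable_on carrier G"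

definition nonzero_Laurent_series ::
    "('a, 'b) ordered_group_scheme \<Rightarrow> nat \<Rightarrow> (nat \<Rightarrow> 'a set) \<Rightarrow> 'a series set" where
  "nonzero_Laurent_series G n Lhat =
     {f. f \<noteq> (\<lambda>_. 0) \<and> series_support f \<subseteq> carrier G \<and>
         (\<exists>t \<in> torus_points G. series_converges_at G f t) \<and>
         (\<exists>C \<in> simple_cones G n Lhat. \<exists>p0 \<in> carrier G. series_support f \<subseteq> C #>\<^bsub>G\<^esub> p0)}"

text \<open>
  The coefficient of \<open>p\<close> in a product is the sum of \<open>f q * g r\<close> over all \<open>q \<otimes> r = p\<close>; only the
  nonzero terms are listed, so that the sum ranges over a finite set for the series at hand.
\<close>

definition series_mult :: "('a, 'b) monoid_scheme \<Rightarrow> 'a series \<Rightarrow> 'a series \<Rightarrow> 'a series" where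
  "series_mult G f g = (\<lambda>p.
     \<Sum>(q, r) \<in> {(q, r). q \<in> series_support f \<and> r \<in> series_support g \<and> q \<otimes>\<^bsub>G\<^esub> r = p}. f q * g r)"

definition Laurent_series_ring ::
    "('a, 'b) ordered_group_scheme \<Rightarrow> nat \<Rightarrow> (nat \<Rightarrow> 'a set) \<Rightarrow> 'a series ring" where
  "Laurent_series_ring G n Lhat =
     \<lparr>carrier = nonzero_Laurent_series G n Lhat \<union> {\<lambda>_. 0},
      monoid.mult = series_mult G,
      one = (\<lambda>p. if p = \<one>\<^bsub>G\<^esub> then 1 else 0),
      zero = (\<lambda>_. 0),
      add = (\<lambda>f g p. f p + g p)\<rparr>"

definition lowest_monomial :: "('a, 'b) ordered_group_scheme \<Rightarrow> 'a series \<Rightarrow> 'a" where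
  "lowest_monomial G f =
     (THE p. p \<in> series_support f \<and> (\<forall>q \<in> series_support f. q \<noteq> p \<longrightarrow> grp_less G p q))"

end

(*
  Choosing elements u_i of Lhat i - Lhat (i - 1) and integer functionals dual to them up to scaling,
  one finds a basis e_1, ..., e_n of the group in which Lhat k is spanned by e_1, ..., e_k and the order
  is lexicographic, read from the last coordinate. In these coordinates the cones
    C_N = {p. c_j p + N c_(j+1) p + ... + N^(n-j) c_n p >= 0 for all j}
  are simple and increase with N, and the positive part of any translate of C_N lies in C_N' for some
  larger N'. Hence every simple cone, and the positive part of each of its translates, lies in C_N for
  all large N.

  The sum of the dual coordinates of C_N is a degree, positive on C_N - {1}, and evaluating at the point
  p |-> eps^(deg p) dominates any given point of convergence as soon as eps is small. So finitely many
  Laurent series may be assumed to live on translates of one cone and to converge at one such point,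
  which gives the ring axioms. Dividing a nonzero series by its lowest term leaves 1 - h with h supported
  in some C_N - {1}; shrinking eps makes the weighted norm of h at most 1/2, and the geometric series
  in h converges to the inverse.
*)
theory Submission
  imports Defs
begin

section \<open>Integer linear algebra\<close>

text \<open>That the order is lexicographic comes from counting. The group has rank \<open>n\<close>
  as a free abelian group and its tower has \<open>n\<close> steps; isolated subgroups are pure, so
  each quotient of neighbours in the tower has rank one. An order like that of Z + Z sqrt 2 inside
  the reals, one step for rank two, is excluded in this way. The obstacle is that cone and point of
  convergence vary with the series, and that division by the lowest term leaves a support in a
  translate of a cone. A positive element may be very negative below its leading coordinate; the
  weights 1, N, N^2, ... let the leading one win as soon as the functionals of a smaller cone are
  bounded below, as they are on its translates. The degree has two uses. As the exponent of
  \<open>\<epsilon>\<close> it measures convergence: every monomial of a cone except the identity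
  has degree at least 1 and shrinks with \<open>\<epsilon>\<close>. As a grading with finitely many
  monomials below each bound it makes products finite sums and lets the geometric series converge
  coefficient by coefficient.\<close>

lemma underdetermined_integer_system:
  fixes v :: "'i \<Rightarrow> 'j \<Rightarrow> int"
  assumes "finite J" "finite I" "card J < card I"
  shows "\<exists>m. (\<exists>i\<in>I. m i \<noteq> 0) \<and> (\<forall>j\<in>J. (\<Sum>i\<in>I. m i * v i j) = 0)"
  using assms
proof (induction J arbitrary: I v rule: finite_induct)
  case empty
  then have "I \<noteq> {}" by auto
  then show ?case by (intro exI[of _ "\<lambda>_. 1"]) auto
next
  case (insert j J)
  show ?case
  proof (cases "\<exists>k\<in>I. v k j \<noteq> 0")
    case False
    have "card J < card I" using insert by simp
    from insert.IH[OF insert.prems(1) this, of v] obtain m where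
      m: "\<exists>i\<in>I. m i \<noteq> 0" "\<forall>j\<in>J. (\<Sum>i\<in>I. m i * v i j) = 0" by blast
    from False m show ?thesis by (intro exI[of _ m]) auto
  next
    case True
    then obtain k where k: "k \<in> I" "v k j \<noteq> 0" by blast
    \<comment> \<open>Fraction-free elimination with pivot \<open>v k j\<close>: the rows
      \<open>w\<close> vanish in column \<open>j\<close>, so one equation and one unknown
      disappear.\<close>
    define w where "w i l = v k j * v i l - v i j * v k l" for i l
    have "card J < card (I - {k})" using insert k by simp
    from insert.IH[OF _ this, of w] insert.prems obtain m where
      m: "\<exists>i\<in>I-{k}. m i \<noteq> 0" "\<And>l. l\<in>J \<Longrightarrow> (\<Sum>i\<in>I-{k}. m i * w i l) = 0" by auto
    \<comment> \<open>Equation \<open>j\<close> is solved for the unknown \<open>k\<close>; scaling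
      the other unknowns by the pivot avoids a division.\<close>
    define m' where "m' i = (if i = k then - (\<Sum>i\<in>I-{k}. m i * v i j) else v k j * m i)" for i
    have *: "(\<Sum>i\<in>I. m' i * v i l) = (\<Sum>i\<in>I-{k}. m i * w i l)" for l
    proof -
      have "(\<Sum>i\<in>I. m' i * v i l) = m' k * v k l + (\<Sum>i\<in>I-{k}. m' i * v i l)"
        using insert.prems k by (simp add: sum.remove)
      also have "(\<Sum>i\<in>I-{k}. m' i * v i l) = (\<Sum>i\<in>I-{k}. v k j * m i * v i l)"
        by (rule sum.cong) (auto simp: m'_def)
      finally show ?thesis
        by (simp add: m'_def w_def sum_distrib_left sum_distrib_right algebra_simps sum_subtractf)
    qed
    have "w i j = 0" for i by (simp add: w_def)
    then have "\<forall>l\<in>insert j J. (\<Sum>i\<in>I. m' i * v i l) = 0" using m * by auto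
    moreover have "\<exists>i\<in>I. m' i \<noteq> 0" using m k by (auto simp: m'_def)
    ultimately show ?thesis by blast
  qed
qed

section \<open>Homomorphisms to the integers and products\<close>

text \<open>Stated for submonoids: besides subgroups it serves for the set \<open>D\<close> in
  \<open>Laurent_imp_tame\<close>, which is cut out of a cone by an inequality.\<close>

lemma (in comm_monoid) finprod_mult_closed:
  assumes "D \<subseteq> carrier G" "\<one> \<in> D" "\<And>p q. p \<in> D \<Longrightarrow> q \<in> D \<Longrightarrow> p \<otimes> q \<in> D" "f \<in> I \<rightarrow> D"
  shows "finprod G f I \<in> D"
proof (cases "finite I")
  case True
  then show ?thesis using assms(4)
  proof (induction I rule: finite_induct)
    case (insert i I)
    then have "finprod G f (insert i I) = f i \<otimes> finprod G f I"
      using assms(1) by (intro finprod_insert) auto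
    then show ?case using insert assms(3) by auto
  qed (simp add: assms(2))
qed (simp add: assms(2))

lemma (in monoid) nat_pow_mult_closed:
  assumes "\<one> \<in> D" "\<And>p q. p \<in> D \<Longrightarrow> q \<in> D \<Longrightarrow> p \<otimes> q \<in> D" "x \<in> D"
  shows "x [^] (k::nat) \<in> D"
  using assms by (induction k) auto

definition int_hom :: "('a, 'b) monoid_scheme \<Rightarrow> ('a \<Rightarrow> int) \<Rightarrow> bool" where
  "int_hom G c \<longleftrightarrow> (\<forall>x\<in>carrier G. \<forall>y\<in>carrier G. c (x \<otimes>\<^bsub>G\<^esub> y) = c x + c y)"

context comm_group
begin

lemma int_hom_mult: "int_hom G c \<Longrightarrow> x \<in> carrier G \<Longrightarrow> y \<in> carrier G \<Longrightarrow> c (x \<otimes> y) = c x + c y"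
  by (simp add: int_hom_def)

lemma int_hom_one: "int_hom G c \<Longrightarrow> c \<one> = 0"
  using int_hom_mult[of c \<one> \<one>] by simp

lemma int_hom_inv: "int_hom G c \<Longrightarrow> x \<in> carrier G \<Longrightarrow> c (inv x) = - c x"
  using int_hom_mult[of c x "inv x"] int_hom_one[of c] by simp

lemma int_hom_nat_pow: "int_hom G c \<Longrightarrow> x \<in> carrier G \<Longrightarrow> c (x [^] (k::nat)) = int k * c x"
  by (induction k) (simp_all add: int_hom_mult int_hom_one algebra_simps)

lemma int_hom_int_pow: "int_hom G c \<Longrightarrow> x \<in> carrier G \<Longrightarrow> c (x [^] (k::int)) = k * c x"
  by (auto simp: int_pow_def2 int_hom_nat_pow int_hom_inv simp del: pow_nat)

lemma int_hom_finprod: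
  assumes "int_hom G c" "finite I" "f \<in> I \<rightarrow> carrier G"
  shows "c (finprod G f I) = (\<Sum>i\<in>I. c (f i))"
  using assms(2,3)
  by (induction I rule: finite_induct) (use assms(1) in \<open>auto simp: int_hom_one int_hom_mult\<close>)

lemma int_hom_lincomb:
  "(\<And>i. i \<in> I \<Longrightarrow> int_hom G (c i)) \<Longrightarrow> int_hom G (\<lambda>p. \<Sum>i\<in>I. a i * c i p)"
  by (simp add: int_hom_def distrib_left sum.distrib)

lemma int_hom_finprod_int_pow:
  assumes "int_hom G c" "finite I" "x \<in> I \<rightarrow> carrier G"
  shows "c (\<Otimes>i\<in>I. x i [^] (k i :: int)) = (\<Sum>i\<in>I. k i * c (x i))"
proof -
  have "(\<lambda>i. x i [^] k i) \<in> I \<rightarrow> carrier G" using assms(3) by auto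
  then show ?thesis
    using assms by (simp add: int_hom_finprod) (rule sum.cong, auto simp: int_hom_int_pow Pi_iff)
qed

lemma finprod_int_pow_add:
  assumes "x \<in> I \<rightarrow> carrier G"
  shows "(\<Otimes>i\<in>I. x i [^] (k i + l i :: int)) = (\<Otimes>i\<in>I. x i [^] k i) \<otimes> (\<Otimes>i\<in>I. x i [^] l i)"
proof -
  have "(\<Otimes>i\<in>I. x i [^] (k i + l i)) = (\<Otimes>i\<in>I. x i [^] k i \<otimes> x i [^] l i)"
    using assms by (intro finprod_cong') (auto simp: int_pow_mult Pi_iff)
  also have "\<dots> = (\<Otimes>i\<in>I. x i [^] k i) \<otimes> (\<Otimes>i\<in>I. x i [^] l i)"
    using assms by (intro finprod_multf) (auto simp: Pi_iff)
  finally show ?thesis .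
qed

lemma subgroup_finprod_closed:
  assumes "subgroup H G" "f \<in> I \<rightarrow> H"
  shows "finprod G f I \<in> H"
  using assms by (intro finprod_mult_closed subgroup.subset subgroup.one_closed subgroup.m_closed)

end

section \<open>Ordered abelian groups\<close>

context ordered_abelian_group
begin

lemma pos_carrier: "p \<in> pos G \<Longrightarrow> p \<in> carrier G"
  using pos_subset by blast

lemma pos_inv_not_pos: "p \<in> pos G \<Longrightarrow> inv p \<notin> pos G"
  using pos_closed[of p "inv p"] one_not_pos pos_carrier by auto

lemma pos_cases:
  assumes "p \<in> carrier G"
  obtains "p = \<one>" | "p \<in> pos G" | "inv p \<in> pos G"
  using neg_inv_pos[of p] assms by blast

lemma pos_nat_pow: "p \<in> pos G \<Longrightarrow> 0 < (m::nat) \<Longrightarrow> p [^] m \<in> pos G"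
proof (induction m)
  case (Suc m)
  then show ?case by (cases "m = 0") (auto simp: pos_carrier intro: pos_closed)
qed simp

lemma isolated_subgroupD:
  assumes "isolated_subgroup G H" "g \<in> pos G" "h \<in> pos G" "g \<otimes> h \<in> H"
  shows "g \<in> H"
proof -
  have "(g \<otimes> h) \<otimes> inv g = h" using assms(2,3) pos_carrier
    by (metis inv_closed inv_solve_left m_closed m_comm)
  then show ?thesis using assms unfolding isolated_subgroup_def grp_less_def by metis
qed

text \<open>A positive \<open>g\<close> is at most any of its positive powers, so isolation pulls it
  into \<open>H\<close>; a negative one is inverted first. In other words, isolated subgroups are
  pure.\<close>

lemma isolated_nat_pow:
  assumes H: "isolated_subgroup G H" and g: "g \<in> carrier G" and "0 < (m::nat)" "g [^] m \<in> H"
  shows "g \<in> H"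
proof -
  have sub: "subgroup H G" using H by (simp add: isolated_subgroup_def)
  have pos: "g \<in> H" if "g \<in> pos G" "g [^] m \<in> H" for g
  proof (cases "m = 1")
    case True with that pos_carrier show ?thesis by auto
  next
    case False
    with assms have "0 < m - 1" "m = Suc (m - 1)" by auto
    with that have "g \<otimes> g [^] (m - 1) \<in> H" "g [^] (m-1) \<in> pos G"
      using pos_nat_pow[OF that(1) \<open>0 < m - 1\<close>] pos_carrier
      by (metis nat_pow_Suc2)+
    then show ?thesis using isolated_subgroupD[OF H that(1)] by blast
  qed
  from g show ?thesis
  proof (cases rule: pos_cases)
    case 1 then show ?thesis using sub by (simp add: subgroup.one_closed)
  next
    case 2 then show ?thesis using pos assms by blast
  next
    case 3
    have "(inv g) [^] m \<in> H" using assms sub by (simp add: nat_pow_inv subgroup.m_inv_closed)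
    with 3 pos have "inv g \<in> H" by blast
    then have "inv (inv g) \<in> H" using sub by (metis subgroup.m_inv_closed)
    then show ?thesis using g by simp
  qed
qed

lemma isolated_int_pow:
  assumes H: "isolated_subgroup G H" and g: "g \<in> carrier G" and "(m::int) \<noteq> 0" "g [^] m \<in> H"
  shows "g \<in> H"
proof -
  have sub: "subgroup H G" using H by (simp add: isolated_subgroup_def)
  have "g [^] nat \<bar>m\<bar> \<in> H"
  proof (cases "m < 0")
    case True
    then have "inv (g [^] m) = g [^] nat \<bar>m\<bar>" using g by (simp add: int_pow_def2 del: pow_nat)
    then show ?thesis using sub assms(4) by (metis subgroup.m_inv_closed)
  next
    case False then show ?thesis using assms by (simp add: int_pow_def2 del: pow_nat)
  qed
  then show ?thesis using isolated_nat_pow[OF H g] assms(3) by (metis zero_less_abs_iff zero_less_nat_eq)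
qed

end

section \<open>Lexicographic coordinates on a flag of lattices\<close>

text \<open>The group as Z^n with coordinates \<open>c\<close>, standard basis \<open>e\<close> and
  the highest nonzero coordinate deciding the sign. The cones are built from these data alone; the
  tower enters again only in \<open>lex_flag\<close>.\<close>

locale lex_lattice = ordered_abelian_group G for G :: "('a, 'b) ordered_group_scheme" (structure) +
  fixes n :: nat and c :: "nat \<Rightarrow> 'a \<Rightarrow> int" and e :: "nat \<Rightarrow> 'a"
  assumes c_hom: "i \<in> {1..n} \<Longrightarrow> int_hom G (c i)"
    and e_closed: "i \<in> {1..n} \<Longrightarrow> e i \<in> carrier G"
    and c_e: "i \<in> {1..n} \<Longrightarrow> j \<in> {1..n} \<Longrightarrow> c i (e j) = (if i = j then 1 else 0)"
    and c_inj: "p \<in> carrier G \<Longrightarrow> q \<in> carrier G \<Longrightarrow> (\<And>i. i \<in> {1..n} \<Longrightarrow> c i p = c i q) \<Longrightarrow> p = q"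
    and pos_lex: "p \<in> carrier G \<Longrightarrow>
      p \<in> pos G \<longleftrightarrow> (\<exists>k\<in>{1..n}. c k p > 0 \<and> (\<forall>i\<in>{k<..n}. c i p = 0))"

context flag_of_lattices
begin

lemma Lhat_0: "Lhat 0 = {\<one>}" and Lhat_n: "Lhat n = carrier G"
  and Lhat_strict: "i < n \<Longrightarrow> Lhat i \<subset> Lhat (Suc i)"
  using tower by (auto simp: isolated_tower_def)

lemma Lhat_isolated: "i \<le> n \<Longrightarrow> isolated_subgroup G (Lhat i)"
  using tower by (auto simp: isolated_tower_def)

lemma Lhat_subgroup: "i \<le> n \<Longrightarrow> subgroup (Lhat i) G"
  using Lhat_isolated by (auto simp: isolated_subgroup_def)

lemma Lhat_mono: "i \<le> j \<Longrightarrow> j \<le> n \<Longrightarrow> Lhat i \<subseteq> Lhat j"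
proof (induction j rule: dec_induct)
  case (step j) then show ?case using Lhat_strict[of j] by auto
qed simp

lemma Lhat_carrier: "i \<le> n \<Longrightarrow> p \<in> Lhat i \<Longrightarrow> p \<in> carrier G"
  using Lhat_subgroup subgroup.mem_carrier by metis

section \<open>Families adapted to the tower: independence and spanning up to multiples\<close>

definition adapted :: "(nat \<Rightarrow> 'a) \<Rightarrow> bool" where
  "adapted x \<longleftrightarrow> (\<forall>i\<in>{1..n}. x i \<in> Lhat i - Lhat (i - 1))"

lemma adapted_carrier: "adapted x \<Longrightarrow> x \<in> {1..n} \<rightarrow> carrier G"
  using Lhat_carrier by (auto simp: adapted_def)

lemma ex_adapted_pos: "\<exists>u. adapted u \<and> (\<forall>i\<in>{1..n}. u i \<in> pos G)"
proof -
  have "\<exists>u. u \<in> Lhat i - Lhat (i - 1) \<and> u \<in> pos G" if i: "i \<in> {1..n}" for i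
  proof -
    obtain u where u: "u \<in> Lhat i" "u \<notin> Lhat (i - 1)"
      using Lhat_strict[of "i - 1"] i by (cases i) auto
    have sub: "subgroup (Lhat i) G" "subgroup (Lhat (i - 1)) G" using i by (auto intro: Lhat_subgroup)
    have uc: "u \<in> carrier G" using u(1) sub(1) subgroup.mem_carrier by metis
    then show ?thesis
    proof (cases rule: pos_cases)
      case 1 then show ?thesis using u sub(2) subgroup.one_closed by metis
    next
      case 2 then show ?thesis using u by blast
    next
      case 3
      have "inv u \<in> Lhat i" using u sub by (simp add: subgroup.m_inv_closed)
      moreover have "inv u \<notin> Lhat (i - 1)" using u(2) sub(2) uc subgroup.m_inv_closed by (metis inv_inv)
      ultimately show ?thesis using 3 by blast
    qed
  qed
  then show ?thesis unfolding adapted_def by metis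
qed

text \<open>Let \<open>t\<close> be the largest index above \<open>k\<close> with a nonzero
  exponent. The whole product and all factors below \<open>t\<close> lie in
  \<open>Lhat (t - 1)\<close>, hence so does \<open>x t [^] m t\<close>, and purity puts
  \<open>x t\<close> itself there. For \<open>k = 0\<close> this is linear independence.\<close>

lemma adapted_exponent_zero:
  assumes x: "adapted x" and "k \<le> n" "(\<Otimes>i\<in>{1..n}. x i [^] (m i :: int)) \<in> Lhat k" "i \<in> {k<..n}"
  shows "m i = 0"
proof (rule ccontr)
  assume "m i \<noteq> 0"
  define T where "T = {i \<in> {k<..n}. m i \<noteq> 0}"
  define t where "t = Max T"
  have fin: "finite T" and "T \<noteq> {}" using \<open>m i \<noteq> 0\<close> assms by (auto simp: T_def)
  then have t: "t \<in> T" and tmax: "\<And>i. i \<in> T \<Longrightarrow> i \<le> t" using Max_in by (auto simp: t_def)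
  have tn: "t \<in> {1..n}" "k < t" "m t \<noteq> 0" using t by (auto simp: T_def)
  have xc: "x i \<in> carrier G" if "i \<in> {1..n}" for i using adapted_carrier[OF x] that by blast
  have sub: "subgroup (Lhat (t - 1)) G" using tn by (intro Lhat_subgroup) auto
  let ?P = "\<lambda>A. \<Otimes>i\<in>A. x i [^] m i"
  have low: "?P {1..<t} \<in> Lhat (t - 1)"
  proof (rule subgroup_finprod_closed[OF sub], rule Pi_I)
    fix i assume i: "i \<in> {1..<t}"
    then have "x i \<in> Lhat i" using x tn by (auto simp: adapted_def)
    moreover have "i \<le> t - 1" "t - 1 \<le> n" using i tn by auto
    ultimately have "x i \<in> Lhat (t - 1)" using Lhat_mono by blast
    then show "x i [^] m i \<in> Lhat (t - 1)" using sub by (simp add: subgroup_int_pow_closed)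
  qed
  have "?P {1..n} = ?P (insert t {1..<t})"
  proof (rule finprod_mono_neutral_cong_right)
    show "x i [^] m i = \<one>" if "i \<in> {1..n} - insert t {1..<t}" for i
    proof -
      from that have "i \<in> {k<..n}" "t < i" using tn by auto
      then have "m i = 0" using tmax[of i] by (auto simp: T_def)
      then show "x i [^] m i = \<one>" by simp
    qed
  qed (use tn xc in auto)
  also have "\<dots> = x t [^] m t \<otimes> ?P {1..<t}" using xc tn by (intro finprod_insert) auto
  finally have "x t [^] m t \<otimes> ?P {1..<t} \<in> Lhat k" using assms by simp
  moreover have "k \<le> t - 1" "t - 1 \<le> n" using tn by auto
  ultimately have "x t [^] m t \<otimes> ?P {1..<t} \<in> Lhat (t - 1)" using Lhat_mono by blast
  then have "(x t [^] m t \<otimes> ?P {1..<t}) \<otimes> inv (?P {1..<t}) \<in> Lhat (t - 1)"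
    using low sub by (simp add: subgroup.m_closed subgroup.m_inv_closed)
  moreover have "?P {1..<t} \<in> carrier G" using xc tn by (intro finprod_closed) auto
  ultimately have "x t [^] m t \<in> Lhat (t - 1)" using xc tn by (simp add: m_assoc)
  then have "x t \<in> Lhat (t - 1)" using isolated_int_pow[OF Lhat_isolated, of "t - 1" "x t" "m t"] tn xc by simp
  then show False using x tn by (auto simp: adapted_def)
qed

lemma ex_coordinates:
  "\<exists>a. (\<forall>j\<in>{1..n}. int_hom G (a j)) \<and>
     (\<forall>p\<in>carrier G. \<forall>q\<in>carrier G. (\<forall>j\<in>{1..n}. a j p = a j q) \<longrightarrow> p = q) \<and>
     (\<forall>z. \<exists>p\<in>carrier G. \<forall>j\<in>{1..n}. a j p = (z j :: int))"
proof -
  obtain \<phi> where \<phi>: "\<phi> \<in> iso G (product_group {1..n} (\<lambda>_. integer_group))"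
    using iso_Zn by (auto simp: is_iso_def)
  then have hom: "\<phi> \<in> hom G (product_group {1..n} (\<lambda>_. integer_group))"
    and bij: "bij_betw \<phi> (carrier G) ({1..n} \<rightarrow>\<^sub>E UNIV)"
    by (auto simp: iso_def)
  have img: "\<phi> p \<in> {1..n} \<rightarrow>\<^sub>E UNIV" if "p \<in> carrier G" for p
    using bij that by (auto simp: bij_betw_def)
  have "int_hom G (\<lambda>p. \<phi> p j)" if "j \<in> {1..n}" for j
    using hom that by (auto simp: int_hom_def hom_def)
  moreover have "p = q"
    if "p \<in> carrier G" "q \<in> carrier G" "\<forall>j\<in>{1..n}. \<phi> p j = \<phi> q j" for p q
  proof -
    have "\<phi> p = \<phi> q" using PiE_ext[OF img[OF that(1)] img[OF that(2)]] that(3) by blast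
    then show ?thesis using bij that by (auto simp: bij_betw_def inj_on_def)
  qed
  moreover have "\<exists>p\<in>carrier G. \<forall>j\<in>{1..n}. \<phi> p j = z j" for z
  proof -
    have "restrict z {1..n} \<in> \<phi> ` carrier G" using bij by (auto simp: bij_betw_def)
    then obtain p where "p \<in> carrier G" "\<phi> p = restrict z {1..n}" by auto
    then show ?thesis by (intro bexI[of _ p]) auto
  qed
  ultimately show ?thesis by (intro exI[of _ "\<lambda>j p. \<phi> p j"]) blast
qed

text \<open>The equality of the two ranks is used here: \<open>n + 1\<close> elements with
  \<open>n\<close> coordinates are dependent, and independence of the adapted family forces the
  coefficient of \<open>g\<close> to be nonzero.\<close>

lemma adapted_spans_multiple:
  assumes x: "adapted x" and g: "g \<in> carrier G"
  shows "\<exists>m ms. m \<noteq> (0::int) \<and> g [^] m = (\<Otimes>i\<in>{1..n}. x i [^] (ms i :: int))"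
proof -
  obtain a where a: "\<And>j. j\<in>{1..n} \<Longrightarrow> int_hom G (a j)"
    and inj: "\<And>p q. p\<in>carrier G \<Longrightarrow> q\<in>carrier G \<Longrightarrow> (\<forall>j\<in>{1..n}. a j p = a j q) \<Longrightarrow> p = q"
    using ex_coordinates by blast
  \<comment> \<open>Index 0 stands for \<open>g\<close>, the indices from 1 on for the family
    \<open>x\<close>.\<close>
  obtain m where m: "\<exists>i\<in>{0..n}. m i \<noteq> 0"
    and eq': "\<forall>j\<in>{1..n}. (\<Sum>i\<in>{0..n}. m i * a j (if i = 0 then g else x i)) = 0"
    using underdetermined_integer_system[of "{1..n}" "{0..n}" "\<lambda>i j. a j (if i = 0 then g else x i)"]
    by (simp only: finite_atLeastAtMost card_atLeastAtMost) auto
  note eq = bspec[OF eq']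
  let ?P = "\<Otimes>i\<in>{1..n}. x i [^] (- m i)"
  have xc: "x \<in> {1..n} \<rightarrow> carrier G" using adapted_carrier[OF x] .
  have Pc: "?P \<in> carrier G" using xc by (intro finprod_closed) auto
  have gP: "g [^] m 0 = ?P"
  proof (rule inj)
    show "\<forall>j\<in>{1..n}. a j (g [^] m 0) = a j ?P"
    proof
      fix j assume j: "j \<in> {1..n}"
      have "a j ?P = (\<Sum>i\<in>{1..n}. - m i * a j (x i))"
        using a[OF j] xc by (intro int_hom_finprod_int_pow) auto
      moreover have "(\<Sum>i\<in>{0..n}. m i * a j (if i = 0 then g else x i)) =
          m 0 * a j g + (\<Sum>i\<in>{1..n}. m i * a j (x i))"
        by (simp add: sum.atLeast_Suc_atMost)
      ultimately show "a j (g [^] m 0) = a j ?P"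
        using eq[OF j] a[OF j] g by (simp add: int_hom_int_pow sum_negf)
    qed
  qed (use g Pc in auto)
  have "m 0 \<noteq> 0"
  proof
    assume 0: "m 0 = 0"
    then have "?P \<in> Lhat 0" using gP Lhat_0 by simp
    then have "- m i = 0" if "i \<in> {0<..n}" for i
      using adapted_exponent_zero[OF x, of 0 "\<lambda>i. - m i"] that by auto
    then show False using m 0 by (metis atLeastAtMost_iff greaterThanAtMost_iff neg_equal_0_iff_equal not_gr_zero)
  qed
  with gP show ?thesis by (intro exI[of _ "m 0"] exI[of _ "\<lambda>i. - m i"]) auto
qed

section \<open>Functionals that detect the tower and the order\<close>

lemma ex_dual_functional:
  assumes u: "adapted u" and k: "k \<in> {1..n}"
  shows "\<exists>d. int_hom G d \<and> d (u k) > 0 \<and> (\<forall>i\<in>{1..n} - {k}. d (u i) = 0)"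
proof -
  obtain a where a: "\<And>j. j\<in>{1..n} \<Longrightarrow> int_hom G (a j)"
    and surj: "\<And>z. \<exists>p\<in>carrier G. \<forall>j\<in>{1..n}. a j p = (z j :: int)"
    using ex_coordinates by blast
  have uc: "u \<in> {1..n} \<rightarrow> carrier G" using adapted_carrier[OF u] .
  \<comment> \<open>The unknowns are the \<open>n\<close> coefficients of \<open>d\<close> with
    respect to the coordinates \<open>a\<close>; the conditions are its values at the
    \<open>n - 1\<close> elements other than \<open>u k\<close>.\<close>
  have "finite ({1..n} - {k})" "card ({1..n} - {k}) < card {1..n}"
    using k by (auto intro: psubset_card_mono)
  from underdetermined_integer_system[OF this(1) finite_atLeastAtMost this(2), of "\<lambda>j i. a j (u i)"]
  obtain m where m: "\<exists>j\<in>{1..n}. m j \<noteq> 0"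
    and eq': "\<forall>i\<in>{1..n} - {k}. (\<Sum>j\<in>{1..n}. m j * a j (u i)) = 0" by blast
  note eq = bspec[OF eq']
  define d where "d p = (\<Sum>j\<in>{1..n}. m j * a j p)" for p
  have d: "int_hom G d" using int_hom_lincomb[of "{1..n}" a m] a by (simp add: d_def [abs_def])
  have "d (u k) \<noteq> 0"
  proof
    assume 0: "d (u k) = 0"
    \<comment> \<open>A functional that also kills \<open>u k\<close> kills a nonzero multiple of
      every element, hence everything; but its coefficients can be read off because the coordinates
      take arbitrary values.\<close>
    have zero: "d g = 0" if g: "g \<in> carrier G" for g
    proof -
      obtain r ms where r: "r \<noteq> (0::int)" "g [^] r = (\<Otimes>i\<in>{1..n}. u i [^] (ms i :: int))"
        using adapted_spans_multiple[OF u g] by blast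
      have "d (u i) = 0" if "i \<in> {1..n}" for i
        using 0 eq that by (cases "i = k") (auto simp: d_def)
      then have "d (\<Otimes>i\<in>{1..n}. u i [^] (ms i :: int)) = 0"
        using int_hom_finprod_int_pow[OF d _ uc, of ms] by simp
      then have "r * d g = 0" using r(2) int_hom_int_pow[OF d g, of r] by simp
      then show ?thesis using r(1) by simp
    qed
    obtain j where j: "j \<in> {1..n}" "m j \<noteq> 0" using m by blast
    obtain p where p: "p \<in> carrier G" "\<forall>i\<in>{1..n}. a i p = (if i = j then 1 else 0)"
      using surj[of "\<lambda>i. if i = j then 1 else 0"] by blast
    have "d p = (\<Sum>i\<in>{1..n}. if i = j then m i else 0)"
      unfolding d_def by (rule sum.cong) (use p in auto)
    then show False using zero[OF p(1)] j by simp
  qed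
  moreover have "int_hom G (\<lambda>p. sgn (d (u k)) * d p)" using d by (auto simp: int_hom_def algebra_simps)
  moreover have "\<forall>i\<in>{1..n} - {k}. d (u i) = 0" using eq by (simp add: d_def)
  ultimately show ?thesis
    by (intro exI[of _ "\<lambda>p. sgn (d (u k)) * d p"]) (auto simp: sgn_if)
qed

text \<open>Expanding a power of \<open>p\<close> in an adapted family shows which functionals
  vanish at \<open>p\<close>, and purity passes from the power back to \<open>p\<close>. For the
  sign, suppose \<open>p\<close> is negative although \<open>d k p > 0\<close>: then positive powers
  of \<open>inv p\<close> and \<open>u k\<close> have a product in \<open>Lhat (k - 1)\<close>, and
  isolation drags \<open>inv p\<close> into it, where \<open>d k\<close> vanishes.\<close>

lemma ex_triangular_functionals:
  "\<exists>d. (\<forall>k\<in>{1..n}. int_hom G (d k)) \<and>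
     (\<forall>k\<le>n. Lhat k = {p \<in> carrier G. \<forall>i\<in>{k<..n}. d i p = 0}) \<and>
     (\<forall>k\<in>{1..n}. \<forall>p\<in>Lhat k. d k p > 0 \<longrightarrow> p \<in> pos G) \<and>
     (\<forall>k\<in>{1..n}. \<exists>p\<in>Lhat k. d k p > 0)"
proof -
  obtain u where u: "adapted u" and upos: "\<And>i. i\<in>{1..n} \<Longrightarrow> u i \<in> pos G"
    using ex_adapted_pos by blast
  have uc: "u \<in> {1..n} \<rightarrow> carrier G" using adapted_carrier[OF u] .
  have uL: "u k \<in> Lhat k" if "k \<in> {1..n}" for k using u that by (auto simp: adapted_def)
  have "\<exists>d. \<forall>k\<in>{1..n}. int_hom G (d k) \<and> d k (u k) > 0 \<and> (\<forall>i\<in>{1..n} - {k}. d k (u i) = 0)"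
    using ex_dual_functional[OF u] by (intro bchoice) blast
  then obtain d where d: "\<And>k. k \<in> {1..n} \<Longrightarrow> int_hom G (d k)"
    and dk: "\<And>k. k \<in> {1..n} \<Longrightarrow> d k (u k) > 0"
    and di: "\<And>k i. k \<in> {1..n} \<Longrightarrow> i\<in>{1..n} - {k} \<Longrightarrow> d k (u i) = 0" by blast
  have L: "Lhat k = {p \<in> carrier G. \<forall>i\<in>{k<..n}. d i p = 0}" if k: "k \<le> n" for k
  proof -
    have "p \<in> Lhat k \<longleftrightarrow> (\<forall>i\<in>{k<..n}. d i p = 0)" if p: "p \<in> carrier G" for p
    proof -
      obtain r ms where r: "r \<noteq> (0::int)" "p [^] r = (\<Otimes>i\<in>{1..n}. u i [^] (ms i :: int))"
        using adapted_spans_multiple[OF u p] by blast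
      have dms: "r * d i p = ms i * d i (u i)" if i: "i \<in> {1..n}" for i
      proof -
        have "r * d i p = d i (\<Otimes>i\<in>{1..n}. u i [^] (ms i :: int))"
          using int_hom_int_pow[OF d[OF i] p, of r] r(2) by simp
        also have "\<dots> = (\<Sum>j\<in>{1..n}. ms j * d i (u j))" using d[OF i] uc by (simp add: int_hom_finprod_int_pow)
        also have "\<dots> = (\<Sum>j\<in>{1..n}. if j = i then ms j * d i (u j) else 0)"
          by (rule sum.cong) (use di i in auto)
        finally show ?thesis using i by simp
      qed
      have sub: "subgroup (Lhat k) G" using Lhat_subgroup[OF k] .
      show ?thesis
      proof
        assume "p \<in> Lhat k"
        then have "p [^] r \<in> Lhat k" using sub by (simp add: subgroup_int_pow_closed)
        then have "ms i = 0" if "i \<in> {k<..n}" for i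
          using adapted_exponent_zero[OF u k, of ms] that r(2) by simp
        then show "\<forall>i\<in>{k<..n}. d i p = 0" using dms r(1) by fastforce
      next
        assume z: "\<forall>i\<in>{k<..n}. d i p = 0"
        have ms: "ms i = 0" if "i \<in> {k<..n}" for i
        proof -
          have "i \<in> {1..n}" using that by auto
          then show ?thesis using dms[of i] dk[of i] z that by simp
        qed
        have "(\<Otimes>i\<in>{1..n}. u i [^] ms i) \<in> Lhat k"
        proof (rule subgroup_finprod_closed[OF sub], rule Pi_I)
          fix i assume i: "i \<in> {1..n}"
          show "u i [^] ms i \<in> Lhat k"
          proof (cases "i \<le> k")
            case True
            then have "u i \<in> Lhat k" using uL[OF i] Lhat_mono[OF True k] by blast
            then show ?thesis using sub by (simp add: subgroup_int_pow_closed)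
          next
            case False
            then show ?thesis using ms[of i] i sub by (simp add: subgroup.one_closed)
          qed
        qed
        then show "p \<in> Lhat k" using isolated_int_pow[OF Lhat_isolated[OF k] p r(1)] r(2) by simp
      qed
    qed
    then show ?thesis using Lhat_carrier[OF k] by blast
  qed
  have P: "p \<in> pos G" if k: "k \<in> {1..n}" and p: "p \<in> Lhat k" "d k p > 0" for k p
  proof (rule ccontr)
    assume np: "p \<notin> pos G"
    have pc: "p \<in> carrier G" using Lhat_carrier k p(1) by auto
    have "p \<noteq> \<one>" using p int_hom_one[OF d[OF k]] by auto
    with np pc have q: "inv p \<in> pos G" by (rule_tac pos_cases[OF pc]) auto
    have dq: "d k (inv p) = - d k p" using int_hom_inv[OF d[OF k] pc] .
    \<comment> \<open>The exponents are swapped values of \<open>d k\<close>, so that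
      \<open>d k\<close> cancels on the product \<open>?h\<close>.\<close>
    define r s where "r = nat (d k (u k))" and "s = nat (d k p)"
    have rs: "0 < r" "0 < s" "int r = d k (u k)" "int s = d k p" using dk[OF k] p by (auto simp: r_def s_def)
    let ?h = "inv p [^] r \<otimes> u k [^] s"
    have ukc: "u k \<in> carrier G" using uc k by blast
    have Lk: "subgroup (Lhat k) G" using k by (intro Lhat_subgroup) auto
    have hk: "d k ?h = 0"
      using d[OF k] ukc pc dq rs by (simp add: int_hom_mult int_hom_nat_pow)
    have "?h \<in> Lhat k"
      using Lk p(1) uL[OF k] by (metis int_pow_int subgroup.m_closed subgroup.m_inv_closed subgroup_int_pow_closed)
    then have "\<forall>i\<in>{k<..n}. d i ?h = 0" using L[of k] k by auto
    with hk have "\<forall>i\<in>{k-1<..n}. d i ?h = 0"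
      by (metis Suc_pred' atLeastAtMost_iff greaterThanAtMost_iff k le_less less_eq_Suc_le not_one_le_zero not_gr_zero)
    then have "?h \<in> Lhat (k - 1)" using L[of "k - 1"] k ukc pc by auto
    moreover have "inv p [^] r \<in> pos G" "u k [^] s \<in> pos G" using rs q upos[OF k] by (auto intro: pos_nat_pow)
    moreover have iso: "isolated_subgroup G (Lhat (k - 1))" using k by (intro Lhat_isolated) auto
    ultimately have "inv p [^] r \<in> Lhat (k - 1)" using isolated_subgroupD by blast
    then have "inv p \<in> Lhat (k - 1)" using isolated_nat_pow[OF iso] rs pc by blast
    then have "d k (inv p) = 0" using L[of "k - 1"] k by auto
    then show False using dq p by simp
  qed
  have E: "\<exists>p\<in>Lhat k. d k p > 0" if "k \<in> {1..n}" for k using uL dk that by blast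
  show ?thesis
  proof (intro exI[of _ d] conjI ballI allI impI)
    show "int_hom G (d k)" if "k \<in> {1..n}" for k using d that .
    show "Lhat k = {p \<in> carrier G. \<forall>i\<in>{k<..n}. d i p = 0}" if "k \<le> n" for k using L that .
    show "p \<in> pos G" if "k \<in> {1..n}" "p \<in> Lhat k" "d k p > 0" for k p using P that .
    show "\<exists>p\<in>Lhat k. d k p > 0" if "k \<in> {1..n}" for k using E that .
  qed
qed

text \<open>Adapted families with dual functionals give a basis only over the rationals. To get one
  over the integers, \<open>e k\<close> is taken in \<open>Lhat k\<close> with the least positive
  value of \<open>d k\<close>; every element of \<open>Lhat k\<close> can then be reduced modulo
  \<open>e k\<close> into \<open>Lhat (k - 1)\<close>.\<close>

lemma ex_lex_coordinates:
  "\<exists>c e. lex_lattice G n c e \<and>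
     (\<forall>k\<le>n. Lhat k = {p \<in> carrier G. \<forall>i\<in>{k<..n}. c i p = 0})"
proof -
  obtain d where d: "\<And>k. k\<in>{1..n} \<Longrightarrow> int_hom G (d k)"
    and L: "\<And>k. k\<le>n \<Longrightarrow> Lhat k = {p \<in> carrier G. \<forall>i\<in>{k<..n}. d i p = 0}"
    and dpos: "\<And>k p. k\<in>{1..n} \<Longrightarrow> p\<in>Lhat k \<Longrightarrow> d k p > 0 \<Longrightarrow> p \<in> pos G"
    and dex: "\<And>k. k\<in>{1..n} \<Longrightarrow> \<exists>p\<in>Lhat k. d k p > 0"
    using ex_triangular_functionals by blast
  have "\<exists>e\<in>Lhat k. d k e > 0 \<and> (\<forall>p\<in>Lhat k. d k e dvd d k p)" if k: "k \<in> {1..n}" for k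
  proof -
    have kn: "k \<le> n" using k by simp
    \<comment> \<open>The values of \<open>d k\<close> on \<open>Lhat k\<close> form a subgroup of
      the integers; by division with remainder its least positive member divides all others.\<close>
    define Q where "Q r \<longleftrightarrow> 0 < r \<and> (\<exists>p\<in>Lhat k. d k p = int r)" for r
    have "\<exists>r. Q r"
    proof -
      obtain p where "p \<in> Lhat k" "d k p > 0" using dex[OF k] by blast
      then show ?thesis by (intro exI[of _ "nat (d k p)"]) (auto simp: Q_def)
    qed
    then have "Q (Least Q)" by (rule LeastI_ex)
    then obtain x where x: "x \<in> Lhat k" "d k x = int (Least Q)" "0 < Least Q" by (auto simp: Q_def)
    have xc: "x \<in> carrier G" using Lhat_carrier[OF kn x(1)] .
    have "d k x dvd d k p" if p: "p \<in> Lhat k" for p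
    proof (rule ccontr)
      assume nd: "\<not> d k x dvd d k p"
      define y where "y = p \<otimes> x [^] (- (d k p div d k x))"
      have yL: "y \<in> Lhat k" unfolding y_def using Lhat_subgroup[OF kn] p x(1)
        by (metis subgroup.m_closed subgroup_int_pow_closed)
      have "d k y = d k p mod d k x" unfolding y_def
        using d[OF k] Lhat_carrier[OF kn p] xc
        by (simp add: int_hom_mult int_hom_int_pow minus_div_mult_eq_mod del: pow_nat)
      moreover have x0: "0 < d k x" using x by simp
      moreover have "d k p mod d k x \<noteq> 0" using nd by (simp add: mod_eq_0_iff_dvd)
      ultimately have "0 < d k y" "d k y < d k x"
        using pos_mod_sign[OF x0, of "d k p"] pos_mod_bound[OF x0, of "d k p"] by linarith+
      then have "Q (nat (d k y))" "nat (d k y) < Least Q" using yL x by (auto simp: Q_def)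
      then show False using not_less_Least by blast
    qed
    then show ?thesis using x by (intro bexI[of _ x]) auto
  qed
  then have "\<exists>e. \<forall>k\<in>{1..n}. e k \<in> Lhat k \<and> d k (e k) > 0 \<and> (\<forall>p\<in>Lhat k. d k (e k) dvd d k p)"
    by (intro bchoice) blast
  then obtain e where eL: "\<And>k. k \<in> {1..n} \<Longrightarrow> e k \<in> Lhat k"
    and dee: "\<And>k. k \<in> {1..n} \<Longrightarrow> d k (e k) > 0"
    and dvd: "\<And>k p. k \<in> {1..n} \<Longrightarrow> p \<in> Lhat k \<Longrightarrow> d k (e k) dvd d k p" by blast
  have ead: "adapted e"
  proof -
    have "e k \<notin> Lhat (k - 1)" if k: "k \<in> {1..n}" for k
    proof
      assume "e k \<in> Lhat (k - 1)"
      then have "d k (e k) = 0" using L[of "k - 1"] k by auto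
      then show False using dee[OF k] by simp
    qed
    then show ?thesis using eL by (auto simp: adapted_def)
  qed
  have ec: "e \<in> {1..n} \<rightarrow> carrier G" using adapted_carrier[OF ead] .
  let ?P = "\<lambda>m. \<Otimes>i\<in>{1..n}. e i [^] (m i :: int)"
  have single: "?P (\<lambda>i. if i = k then r else 0) = e k [^] r" if k: "k \<in> {1..n}" for k r
  proof -
    have ek: "e i [^] r \<in> carrier G" if "i \<in> {1..n}" for i using ec that by auto
    have "?P (\<lambda>i. if i = k then r else 0) = (\<Otimes>i\<in>{1..n}. if k = i then e i [^] r else \<one>)"
      using ek k by (intro finprod_cong') auto
    also have "\<dots> = e k [^] r" using k ek by (intro finprod_singleton) auto
    finally show ?thesis .
  qed
  have "\<forall>p\<in>Lhat k. \<exists>m. p = ?P m" if "k \<le> n" for k using that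
  proof (induction k)
    case 0
    have "?P (\<lambda>_. 0) = \<one>" by (simp add: finprod_one_eqI)
    then show ?case using Lhat_0 by (intro ballI exI[of _ "\<lambda>_. 0"]) simp
  next
    case (Suc k)
    show ?case
    proof
      fix p assume p: "p \<in> Lhat (Suc k)"
      have k: "Suc k \<in> {1..n}" using Suc by auto
      \<comment> \<open>Removing the component along \<open>e (Suc k)\<close> kills
        \<open>d (Suc k)\<close>, so \<open>q\<close> falls into \<open>Lhat k\<close> and the
        induction hypothesis applies.\<close>
      define r where "r = d (Suc k) p div d (Suc k) (e (Suc k))"
      have r: "d (Suc k) p = r * d (Suc k) (e (Suc k))" using dvd[OF k p] by (simp add: r_def)
      define q where "q = p \<otimes> e (Suc k) [^] (- r)"
      have pc: "p \<in> carrier G" and ekc: "e (Suc k) \<in> carrier G" using p Lhat_carrier Suc.prems ec k by auto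
      have qL: "q \<in> Lhat (Suc k)" unfolding q_def using Lhat_subgroup[OF Suc.prems] p eL[OF k]
        by (metis subgroup.m_closed subgroup_int_pow_closed)
      have "d (Suc k) q = 0" unfolding q_def using d[OF k] pc ekc r
        by (simp add: int_hom_mult int_hom_int_pow)
      moreover have "q \<in> carrier G" "\<forall>i\<in>{Suc k<..n}. d i q = 0" using qL L[OF Suc.prems] by auto
      moreover have "{k<..n} = insert (Suc k) {Suc k<..n}" using k by auto
      moreover have "k \<le> n" using k by simp
      ultimately have "q \<in> Lhat k" using L[of k] by simp
      then obtain m where m: "q = ?P m" using Suc by auto
      have "p = q \<otimes> e (Suc k) [^] r" unfolding q_def using pc ekc
        by (simp add: m_assoc flip: int_pow_mult)
      also have "\<dots> = ?P (\<lambda>i. m i + (if i = Suc k then r else 0))"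
        using finprod_int_pow_add[OF ec, of m] single[OF k, of r] m by simp
      finally show "\<exists>m. p = ?P m" by (rule exI[of _ "\<lambda>i. m i + (if i = Suc k then r else 0)"])
    qed
  qed
  from this[of n] have "\<forall>p\<in>carrier G. \<exists>m. p = ?P m" using Lhat_n by simp
  from bchoice[OF this] obtain m where m: "\<And>p. p \<in> carrier G \<Longrightarrow> p = ?P (m p)" by blast
  have Pc: "?P r \<in> carrier G" for r using ec by (intro finprod_closed) auto
  have neg: "inv (?P r) = ?P (\<lambda>i. - r i)" for r
  proof -
    have "?P (\<lambda>i. - r i) \<otimes> ?P r = ?P (\<lambda>i. - r i + r i)" by (rule finprod_int_pow_add[OF ec, symmetric])
    also have "\<dots> = \<one>" by (simp add: finprod_one_eqI)
    finally show ?thesis using Pc by (metis inv_equality)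
  qed
  have uniq: "r i = s i" if "?P r = ?P s" "i \<in> {1..n}" for r s i
  proof -
    have "?P (\<lambda>i. r i + - s i) = ?P r \<otimes> inv (?P s)" using finprod_int_pow_add[OF ec, of r "\<lambda>i. - s i"] neg by simp
    also have "\<dots> = \<one>" using that Pc by simp
    finally have "?P (\<lambda>i. r i + - s i) \<in> Lhat 0" using Lhat_0 by simp
    from adapted_exponent_zero[OF ead _ this, of i] that show ?thesis by auto
  qed
  \<comment> \<open>\<open>m\<close> was obtained by choice; only the uniqueness of exponents makes
    \<open>c\<close> additive.\<close>
  define c where "c i p = m p i" for i p
  have Pm: "c i (?P r) = r i" if "i \<in> {1..n}" for i r
    using uniq[OF m[OF Pc, of r, symmetric] that] by (simp add: c_def)
  have chom: "int_hom G (c i)" if i: "i \<in> {1..n}" for i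
  proof -
    have "c i (p \<otimes> q) = c i p + c i q" if "p \<in> carrier G" "q \<in> carrier G" for p q
    proof -
      have "p \<otimes> q = ?P (m p) \<otimes> ?P (m q)" using m that by simp
      also have "\<dots> = ?P (\<lambda>i. m p i + m q i)" by (rule finprod_int_pow_add[OF ec, symmetric])
      finally have "p \<otimes> q = ?P (\<lambda>i. m p i + m q i)" .
      then show ?thesis using Pm[OF i, of "\<lambda>i. m p i + m q i"] by (simp add: c_def)
    qed
    then show ?thesis by (simp add: int_hom_def)
  qed
  have ce: "c i (e j) = (if i = j then 1 else 0)" if "i \<in> {1..n}" "j \<in> {1..n}" for i j
  proof -
    have "e j [^] (1::int) = e j" using ec that by (intro int_pow_1) auto
    then show ?thesis
      using Pm[OF that(1), of "\<lambda>i. if i = j then 1 else 0"] single[OF that(2), of 1] by simp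
  qed
  have cinj: "p = q" if "p \<in> carrier G" "q \<in> carrier G" "\<And>i. i \<in> {1..n} \<Longrightarrow> c i p = c i q" for p q
  proof -
    have "?P (m p) = ?P (m q)" using that ec by (intro finprod_cong') (auto simp: c_def)
    then show ?thesis using m[OF that(1)] m[OF that(2)] by simp
  qed
  have Lc: "Lhat k = {p \<in> carrier G. \<forall>i\<in>{k<..n}. c i p = 0}" if k: "k \<le> n" for k
  proof -
    have "\<forall>i\<in>{k<..n}. c i p = 0" if "p \<in> Lhat k" for p
      using adapted_exponent_zero[OF ead k, of "m p"] m[of p] that Lhat_carrier[OF k] by (auto simp: c_def)
    moreover have "p \<in> Lhat k" if p: "p \<in> carrier G" "\<forall>i\<in>{k<..n}. c i p = 0" for p
    proof -
      have sub: "subgroup (Lhat k) G" using Lhat_subgroup[OF k] .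
      have "?P (m p) \<in> Lhat k"
      proof (rule subgroup_finprod_closed[OF sub], rule Pi_I)
        fix i assume i: "i \<in> {1..n}"
        show "e i [^] m p i \<in> Lhat k"
        proof (cases "i \<le> k")
          case True
          then have "e i \<in> Lhat k" using eL[OF i] Lhat_mono[OF True k] by blast
          then show ?thesis using sub by (simp add: subgroup_int_pow_closed)
        next
          case False
          then have "m p i = 0" using p(2) i by (simp add: c_def)
          then show ?thesis using sub by (simp add: subgroup.one_closed)
        qed
      qed
      then show ?thesis using m[OF p(1)] by simp
    qed
    ultimately show ?thesis using Lhat_carrier[OF k] by blast
  qed
  have top_pos: "p \<in> pos G" if k: "k \<in> {1..n}" and p: "p \<in> carrier G" "c k p > 0" "\<forall>i\<in>{k<..n}. c i p = 0" for k p
  proof -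
    have pL: "p \<in> Lhat k" using Lc[of k] k p by auto
    \<comment> \<open>Only the summand \<open>i = k\<close> survives: below \<open>k\<close> the
      functional kills \<open>e i\<close>, which lies in \<open>Lhat i\<close>, and above
      \<open>k\<close> the coordinate of \<open>p\<close> is zero.\<close>
    have "d k p = d k (?P (m p))" using m[OF p(1)] by simp
    also have "\<dots> = (\<Sum>i\<in>{1..n}. m p i * d k (e i))" using d[OF k] ec by (simp add: int_hom_finprod_int_pow)
    also have "\<dots> = (\<Sum>i\<in>{1..n}. if i = k then m p i * d k (e i) else 0)"
    proof (rule sum.cong[OF refl])
      fix i assume i: "i \<in> {1..n}"
      show "m p i * d k (e i) = (if i = k then m p i * d k (e i) else 0)"
      proof (cases i k rule: linorder_cases)
        case less
        then have "d k (e i) = 0" using eL[OF i] L[of i] i k by auto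
        then show ?thesis using less by simp
      next
        case greater
        then show ?thesis using p(3) i by (auto simp: c_def)
      qed simp
    qed
    also have "\<dots> = c k p * d k (e k)" using k by (simp add: c_def)
    finally show ?thesis using dpos[OF k pL] p(2) dee[OF k] by simp
  qed
  have lex: "p \<in> pos G \<longleftrightarrow> (\<exists>k\<in>{1..n}. c k p > 0 \<and> (\<forall>i\<in>{k<..n}. c i p = 0))" if p: "p \<in> carrier G" for p
  proof
    assume pp: "p \<in> pos G"
    define T where "T = {i \<in> {1..n}. c i p \<noteq> 0}"
    have "T \<noteq> {}"
    proof
      assume "T = {}"
      then have "p = \<one>" using p chom by (intro cinj) (auto simp: T_def int_hom_one)
      then show False using pp one_not_pos by simp
    qed
    define k where "k = Max T"
    have fin: "finite T" by (simp add: T_def)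
    have k: "k \<in> {1..n}" "c k p \<noteq> 0" using Max_in[OF fin \<open>T \<noteq> {}\<close>] by (auto simp: k_def T_def)
    have z: "\<forall>i\<in>{k<..n}. c i p = 0"
      using Max_ge[OF fin] by (fastforce simp: k_def T_def)
    have "c k p > 0"
    proof (rule ccontr)
      assume "\<not> c k p > 0"
      then have "c k (inv p) > 0" using k int_hom_inv[OF chom[OF k(1)] p] by simp
      moreover have "\<forall>i\<in>{k<..n}. c i (inv p) = 0" using z int_hom_inv[OF chom p] by auto
      ultimately have "inv p \<in> pos G" using top_pos[OF k(1)] p by simp
      then show False using pos_inv_not_pos[OF pp] by simp
    qed
    then show "\<exists>k\<in>{1..n}. c k p > 0 \<and> (\<forall>i\<in>{k<..n}. c i p = 0)" using k z by blast
  qed (use top_pos p in blast)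
  have "lex_lattice G n c e"
    by unfold_locales (use chom ce cinj lex ec in auto)
  then show ?thesis using Lc by blast
qed

end

section \<open>Convolution of series supported in a graded cone\<close>

text \<open>Supports are replaced by fixed larger sets, so that sums belonging to different series
  run over the same index set.\<close>

definition factorizations :: "('a, 'b) monoid_scheme \<Rightarrow> 'a set \<Rightarrow> 'a set \<Rightarrow> 'a \<Rightarrow> ('a \<times> 'a) set" where
  "factorizations G A B p = {(q, r). q \<in> A \<and> r \<in> B \<and> q \<otimes>\<^bsub>G\<^esub> r = p}"

definition series_monomial :: "'a \<Rightarrow> complex \<Rightarrow> 'a series" where
  "series_monomial a z = (\<lambda>p. if p = a then z else 0)"

lemma series_mult_eq_sum:
  assumes "series_support f \<subseteq> A" "series_support g \<subseteq> B" "finite (factorizations G A B p)"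
  shows "series_mult G f g p = (\<Sum>(q, r)\<in>factorizations G A B p. f q * g r)"
  unfolding series_mult_def
  by (rule sum.mono_neutral_left) (use assms in \<open>auto simp: factorizations_def series_support_def\<close>)

lemma series_mult_support:
  assumes "p \<in> series_support (series_mult G f g)"
  obtains q r where "q \<in> series_support f" "r \<in> series_support g" "p = q \<otimes>\<^bsub>G\<^esub> r"
proof -
  have "{(q, r). q \<in> series_support f \<and> r \<in> series_support g \<and> q \<otimes>\<^bsub>G\<^esub> r = p} \<noteq> {}" (is "?S \<noteq> {}")
  proof
    assume "?S = {}"
    then have "series_mult G f g p = 0" by (simp only: series_mult_def sum.empty)
    then show False using assms by (simp add: series_support_def)
  qed
  then show ?thesis using that by blast
qed

context comm_group
begin

lemma series_mult_commute:
  assumes "series_support f \<subseteq> carrier G" "series_support g \<subseteq> carrier G"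
  shows "series_mult G f g = series_mult G g f"
proof
  fix p
  show "series_mult G f g p = series_mult G g f p"
    unfolding series_mult_def
    by (rule sum.reindex_bij_witness[where i = prod.swap and j = prod.swap])
      (use assms in \<open>auto simp: m_comm subset_iff\<close>)
qed

lemma series_monomial_mult:
  assumes a: "a \<in> carrier G" and f: "series_support f \<subseteq> carrier G" and p: "p \<in> carrier G"
  shows "series_mult G (series_monomial a z) f p = z * f (inv a \<otimes> p)"
proof -
  have "factorizations G {a} (carrier G) p = {(a, inv a \<otimes> p)}"
    using a p by (auto simp: factorizations_def inv_solve_left) (simp add: m_assoc[symmetric])
  moreover have "series_support (series_monomial a z) \<subseteq> {a}"
    by (auto simp: series_support_def series_monomial_def)
  ultimately show ?thesis
    using series_mult_eq_sum[of "series_monomial a z" "{a}" f "carrier G" G p] f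
    by (simp add: series_monomial_def)
qed

lemma series_mult_one:
  assumes f: "series_support f \<subseteq> carrier G"
  shows "series_mult G (series_monomial \<one> 1) f = f"
proof
  fix p
  show "series_mult G (series_monomial \<one> 1) f p = f p"
  proof (cases "p \<in> carrier G")
    case True then show ?thesis using series_monomial_mult[OF one_closed f, of p 1] by simp
  next
    case False
    have "p \<notin> series_support (series_mult G (series_monomial \<one> 1) f)"
    proof
      assume "p \<in> series_support (series_mult G (series_monomial \<one> 1) f)"
      then obtain q r where "q \<in> series_support (series_monomial \<one> 1)" "r \<in> series_support f" "p = q \<otimes> r"
        by (rule series_mult_support)
      then show False using False f by (auto simp: series_support_def series_monomial_def split: if_splits)
    qed
    then show ?thesis using False f by (auto simp: series_support_def)
  qed
qed

end

text \<open>What the algebra and the norms use of a cone. Finitely many elements below each degree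
  make convolutions finite, positivity of the degree drives the contraction and the geometric
  series, and \<open>C_generates\<close> makes the translates of \<open>C\<close> directed.\<close>

locale graded_cone = comm_group G for G :: "('a, 'b) monoid_scheme" (structure) +
  fixes C :: "'a set" and deg :: "'a \<Rightarrow> int"
  assumes C_carrier: "C \<subseteq> carrier G"
    and C_one: "\<one> \<in> C"
    and C_mult: "p \<in> C \<Longrightarrow> q \<in> C \<Longrightarrow> p \<otimes> q \<in> C"
    and deg_hom: "int_hom G deg"
    and deg_pos: "p \<in> C \<Longrightarrow> p \<noteq> \<one> \<Longrightarrow> deg p > 0"
    and deg_finite: "finite {p \<in> C. deg p \<le> d}"
    and C_generates: "p \<in> carrier G \<Longrightarrow> \<exists>q\<in>C. p \<otimes> q \<in> C"
begin

lemma deg_nonneg: "p \<in> C \<Longrightarrow> deg p \<ge> 0"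
  using deg_pos[of p] int_hom_one[OF deg_hom] by (cases "p = \<one>") auto

lemma deg_mult: "p \<in> carrier G \<Longrightarrow> q \<in> carrier G \<Longrightarrow> deg (p \<otimes> q) = deg p + deg q"
  using int_hom_mult[OF deg_hom] .

lemma translate_carrier: "p \<in> carrier G \<Longrightarrow> C #> p \<subseteq> carrier G"
  using C_carrier by (auto simp: r_coset_def)

lemma translate_one: "C #> \<one> = C"
  using C_carrier by (rule coset_mult_one)

lemma translate_mult:
  assumes "p \<in> carrier G" "q \<in> carrier G" "a \<in> C #> p" "b \<in> C #> q"
  shows "a \<otimes> b \<in> C #> (p \<otimes> q)"
proof -
  obtain c d where c: "c \<in> C" "d \<in> C" "a = c \<otimes> p" "b = d \<otimes> q"
    using assms by (auto simp: r_coset_def)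
  moreover have "a \<otimes> b = (c \<otimes> d) \<otimes> (p \<otimes> q)"
    using c assms C_carrier by (simp add: subset_iff m_ac)
  ultimately show ?thesis using C_mult by (auto simp: r_coset_def)
qed

text \<open>The cone parts of the two factors have nonnegative degrees with a prescribed sum, so
  each degree is bounded by that sum.\<close>

lemma finite_factorizations:
  assumes "p1 \<in> carrier G" "p2 \<in> carrier G"
  shows "finite (factorizations G (C #> p1) (C #> p2) p)"
proof -
  define d where "d = deg p - deg p1 - deg p2"
  let ?D = "{x \<in> C. deg x \<le> d}"
  have "factorizations G (C #> p1) (C #> p2) p \<subseteq> (\<lambda>(a, b). (a \<otimes> p1, b \<otimes> p2)) ` (?D \<times> ?D)"
  proof
    fix z assume "z \<in> factorizations G (C #> p1) (C #> p2) p"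
    then obtain a b where ab: "a \<in> C" "b \<in> C" "z = (a \<otimes> p1, b \<otimes> p2)" "(a \<otimes> p1) \<otimes> (b \<otimes> p2) = p"
      by (auto simp: factorizations_def r_coset_def)
    have "a \<in> carrier G" "b \<in> carrier G" using ab C_carrier by auto
    then have "deg a + deg b = d" using ab(4)[symmetric] assms by (simp add: deg_mult d_def)
    then have "deg a \<le> d" "deg b \<le> d" using deg_nonneg[OF ab(1)] deg_nonneg[OF ab(2)] by auto
    then show "z \<in> (\<lambda>(a, b). (a \<otimes> p1, b \<otimes> p2)) ` (?D \<times> ?D)" using ab by force
  qed
  then show ?thesis by (rule finite_subset) (intro finite_imageI finite_cartesian_product deg_finite)
qed

text \<open>If \<open>c1\<close> and \<open>c2\<close> in \<open>C\<close> push \<open>p1\<close>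
  and \<open>p2\<close> into \<open>C\<close>, then translating by the inverse of
  \<open>c1 \<otimes> c2\<close> covers both. This is why sums of series on different translates of
  one cone stay on a translate of it.\<close>

lemma translates_directed:
  assumes "p1 \<in> carrier G" "p2 \<in> carrier G"
  shows "\<exists>p\<in>carrier G. C #> p1 \<subseteq> C #> p \<and> C #> p2 \<subseteq> C #> p"
proof -
  obtain c1 c2 where c: "c1 \<in> C" "c2 \<in> C" "p1 \<otimes> c1 \<in> C" "p2 \<otimes> c2 \<in> C"
    using C_generates assms by metis
  have cc: "c1 \<in> carrier G" "c2 \<in> carrier G" using c C_carrier by auto
  let ?p = "inv (c1 \<otimes> c2)"
  have *: "C #> q \<subseteq> C #> ?p" if q: "q \<in> carrier G" "a \<in> C" "b \<in> C" "q \<otimes> a \<in> C" "a \<otimes> b = c1 \<otimes> c2" for q a b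
  proof
    fix x assume "x \<in> C #> q"
    then obtain d where d: "d \<in> C" "x = d \<otimes> q" by (auto simp: r_coset_def)
    have ca: "a \<in> carrier G" "b \<in> carrier G" "d \<in> carrier G" using q d C_carrier by auto
    have "d \<otimes> ((q \<otimes> a) \<otimes> b) \<otimes> ?p = d \<otimes> q \<otimes> ((a \<otimes> b) \<otimes> inv (a \<otimes> b))"
      using q(1) ca by (simp add: m_assoc q(5)[symmetric] del: r_inv)
    also have "\<dots> = x" using q(1) ca d by simp
    finally have "x = d \<otimes> ((q \<otimes> a) \<otimes> b) \<otimes> ?p" by simp
    moreover have "d \<otimes> ((q \<otimes> a) \<otimes> b) \<in> C" using d q C_mult by blast
    ultimately show "x \<in> C #> ?p" by (auto simp: r_coset_def)
  qed
  have "c2 \<otimes> c1 = c1 \<otimes> c2" by (rule m_comm[OF cc(2,1)])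
  with *[OF assms(1) c(1,2,3) refl] *[OF assms(2) c(2,1,4)] show ?thesis using cc by blast
qed

definition cone_supported :: "'a series \<Rightarrow> bool" where
  "cone_supported f \<longleftrightarrow> (\<exists>p\<in>carrier G. series_support f \<subseteq> C #> p)"

lemma cone_supported_carrier: "cone_supported f \<Longrightarrow> series_support f \<subseteq> carrier G"
  using translate_carrier unfolding cone_supported_def by blast

lemma cone_supported_add:
  assumes "cone_supported f" "cone_supported g"
  shows "\<exists>p\<in>carrier G. series_support f \<subseteq> C #> p \<and> series_support g \<subseteq> C #> p"
  using assms translates_directed unfolding cone_supported_def by (meson subset_trans)

lemma series_mult_add:
  assumes f: "cone_supported f" and f': "cone_supported f'" and g: "cone_supported g"
  shows "series_mult G (\<lambda>p. f p + f' p) g = (\<lambda>p. series_mult G f g p + series_mult G f' g p)"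
proof
  fix p
  obtain a where a: "a \<in> carrier G" "series_support f \<subseteq> C #> a" "series_support f' \<subseteq> C #> a"
    using cone_supported_add[OF f f'] by blast
  obtain b where b: "b \<in> carrier G" "series_support g \<subseteq> C #> b"
    using g by (auto simp: cone_supported_def)
  have s: "series_support (\<lambda>p. f p + f' p) \<subseteq> C #> a"
    using a(2,3) by (force simp: series_support_def subset_iff)
  note eq = series_mult_eq_sum[OF _ b(2) finite_factorizations[OF a(1) b(1)]]
  show "series_mult G (\<lambda>p. f p + f' p) g p = series_mult G f g p + series_mult G f' g p"
    unfolding eq[OF s] eq[OF a(2)] eq[OF a(3)]
    by (simp add: sum.distrib[symmetric] case_prod_unfold distrib_right)
qed

lemma series_mult_supported:
  assumes "a \<in> carrier G" "b \<in> carrier G" "series_support f \<subseteq> C #> a" "series_support g \<subseteq> C #> b"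
  shows "series_support (series_mult G f g) \<subseteq> C #> (a \<otimes> b)"
proof
  fix p assume "p \<in> series_support (series_mult G f g)"
  then obtain q r where "q \<in> series_support f" "r \<in> series_support g" "p = q \<otimes> r"
    by (rule series_mult_support)
  then show "p \<in> C #> (a \<otimes> b)" using translate_mult[OF assms(1,2)] assms(3,4) by blast
qed

text \<open>Both sides are sums over triples \<open>q\<close>, \<open>r\<close>, \<open>s\<close>
  with product \<open>p\<close>. The nested pairs record the triple as a factorization of a factor,
  on the left or on the right, and the reindexing moves the bracket.\<close>

lemma series_mult_assoc:
  assumes f: "cone_supported f" and g: "cone_supported g" and h: "cone_supported h"
  shows "series_mult G (series_mult G f g) h = series_mult G f (series_mult G g h)"
proof
  fix p
  obtain a where a: "a \<in> carrier G" "series_support f \<subseteq> C #> a" using f by (auto simp: cone_supported_def)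
  obtain b where b: "b \<in> carrier G" "series_support g \<subseteq> C #> b" using g by (auto simp: cone_supported_def)
  obtain c where c: "c \<in> carrier G" "series_support h \<subseteq> C #> c" using h by (auto simp: cone_supported_def)
  let ?A = "C #> a" and ?B = "C #> b" and ?D = "C #> c"
  let ?AB = "C #> (a \<otimes> b)" and ?BD = "C #> (b \<otimes> c)"
  let ?F = "factorizations G"
  have ab: "a \<otimes> b \<in> carrier G" and bc: "b \<otimes> c \<in> carrier G" using a b c by auto
  have AB: "x \<otimes> y \<in> ?AB" if "x \<in> ?A" "y \<in> ?B" for x y using translate_mult[OF a(1) b(1) that] .
  have BD: "x \<otimes> y \<in> ?BD" if "x \<in> ?B" "y \<in> ?D" for x y using translate_mult[OF b(1) c(1) that] .
  have car: "x \<in> carrier G" if "x \<in> ?A \<or> x \<in> ?B \<or> x \<in> ?D" for x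
    using that a b c translate_carrier by blast
  have "series_mult G (series_mult G f g) h p =
      (\<Sum>(u, s)\<in>?F ?AB ?D p. series_mult G f g u * h s)"
    by (intro series_mult_eq_sum series_mult_supported finite_factorizations a b c ab)
  also have "\<dots> = (\<Sum>us\<in>?F ?AB ?D p. \<Sum>qr\<in>?F ?A ?B (fst us). f (fst qr) * g (snd qr) * h (snd us))"
    by (rule sum.cong)
      (auto simp: series_mult_eq_sum[OF a(2) b(2) finite_factorizations[OF a(1) b(1)]]
        sum_distrib_right case_prod_unfold)
  also have "\<dots> = (\<Sum>(us, qr)\<in>(SIGMA us:?F ?AB ?D p. ?F ?A ?B (fst us)). f (fst qr) * g (snd qr) * h (snd us))"
    by (rule sum.Sigma) (auto intro: finite_factorizations a b c ab)
  also have "\<dots> = (\<Sum>(qv, rs)\<in>(SIGMA qv:?F ?A ?BD p. ?F ?B ?D (snd qv)). f (fst qv) * (g (fst rs) * h (snd rs)))"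
  proof (rule sum.reindex_bij_witness[where
        i = "\<lambda>((q, v), (r, s)). ((q \<otimes> r, s), (q, r))" and j = "\<lambda>((u, s), (q, r)). ((q, r \<otimes> s), (r, s))"])
  qed (auto simp: factorizations_def AB BD car m_assoc)
  also have "\<dots> = (\<Sum>qv\<in>?F ?A ?BD p. \<Sum>rs\<in>?F ?B ?D (snd qv). f (fst qv) * (g (fst rs) * h (snd rs)))"
    by (rule sum.Sigma[symmetric]) (auto intro: finite_factorizations a b c bc)
  also have "\<dots> = (\<Sum>(q, v)\<in>?F ?A ?BD p. f q * series_mult G g h v)"
    by (rule sum.cong)
      (auto simp: series_mult_eq_sum[OF b(2) c(2) finite_factorizations[OF b(1) c(1)]]
        sum_distrib_left case_prod_unfold)
  also have "\<dots> = series_mult G f (series_mult G g h) p"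
    by (rule series_mult_eq_sum[symmetric]) (intro series_mult_supported finite_factorizations a b c bc)+
  finally show "series_mult G (series_mult G f g) h p = series_mult G f (series_mult G g h) p" .
qed

section \<open>Weighted norms\<close>

text \<open>A bound for the weighted l1 norm, that is, absolute convergence at the torus point
  \<open>\<epsilon> powi deg p\<close> with an explicit constant. Bounding finite partial sums makes
  it pass to coefficientwise limits directly.\<close>

definition norm_bound :: "real \<Rightarrow> 'a series \<Rightarrow> real \<Rightarrow> bool" where
  "norm_bound \<epsilon> f K \<longleftrightarrow> (\<forall>P. finite P \<longrightarrow> P \<subseteq> carrier G \<longrightarrow> (\<Sum>p\<in>P. norm (f p) * \<epsilon> powi deg p) \<le> K)"

lemma norm_boundD:
  "norm_bound \<epsilon> f K \<Longrightarrow> finite P \<Longrightarrow> P \<subseteq> carrier G \<Longrightarrow> (\<Sum>p\<in>P. norm (f p) * \<epsilon> powi deg p) \<le> K"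
  by (simp add: norm_bound_def)

lemma norm_bound_nonneg: "norm_bound \<epsilon> f K \<Longrightarrow> K \<ge> 0"
  using norm_boundD[of \<epsilon> f K "{}"] by simp

lemma norm_bound_mono: "norm_bound \<epsilon> f K \<Longrightarrow> K \<le> K' \<Longrightarrow> norm_bound \<epsilon> f K'"
  unfolding norm_bound_def by (meson order_trans)

lemma norm_bound_dominated:
  assumes "norm_bound \<epsilon> f K" "\<epsilon> > 0" "\<And>p. p \<in> carrier G \<Longrightarrow> norm (g p) \<le> norm (f p)"
  shows "norm_bound \<epsilon> g K"
  unfolding norm_bound_def
proof (intro allI impI)
  fix P assume P: "finite P" "P \<subseteq> carrier G"
  have "(\<Sum>p\<in>P. norm (g p) * \<epsilon> powi deg p) \<le> (\<Sum>p\<in>P. norm (f p) * \<epsilon> powi deg p)"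
    by (rule sum_mono, rule mult_right_mono) (use assms P in auto)
  also have "\<dots> \<le> K" using norm_boundD[OF assms(1) P] .
  finally show "(\<Sum>p\<in>P. norm (g p) * \<epsilon> powi deg p) \<le> K" .
qed

lemma norm_bound_add:
  assumes "norm_bound \<epsilon> f K" "norm_bound \<epsilon> g K'" "\<epsilon> > 0"
  shows "norm_bound \<epsilon> (\<lambda>p. f p + g p) (K + K')"
  unfolding norm_bound_def
proof (intro allI impI)
  fix P assume P: "finite P" "P \<subseteq> carrier G"
  have "(\<Sum>p\<in>P. norm (f p + g p) * \<epsilon> powi deg p)
      \<le> (\<Sum>p\<in>P. norm (f p) * \<epsilon> powi deg p + norm (g p) * \<epsilon> powi deg p)"
    by (rule sum_mono) (simp add: distrib_right[symmetric] mult_right_mono norm_triangle_ineq assms)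
  also have "\<dots> \<le> K + K'"
    unfolding sum.distrib using norm_boundD[OF assms(1) P] norm_boundD[OF assms(2) P] by simp
  finally show "(\<Sum>p\<in>P. norm (f p + g p) * \<epsilon> powi deg p) \<le> K + K'" .
qed

lemma norm_bound_monomial:
  assumes "\<epsilon> > 0"
  shows "norm_bound \<epsilon> (series_monomial a z) (norm z * \<epsilon> powi deg a)"
  unfolding norm_bound_def
proof (intro allI impI)
  fix P :: "'a set" assume P: "finite P"
  have "(\<Sum>p\<in>P. norm (series_monomial a z p) * \<epsilon> powi deg p) = (\<Sum>p\<in>P. if p = a then norm z * \<epsilon> powi deg a else 0)"
    by (rule sum.cong) (auto simp: series_monomial_def)
  also have "\<dots> \<le> norm z * \<epsilon> powi deg a" using P assms by simp
  finally show "(\<Sum>p\<in>P. norm (series_monomial a z p) * \<epsilon> powi deg p) \<le> norm z * \<epsilon> powi deg a" .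
qed

text \<open>Submultiplicativity of the weighted l1 norm; the weight is multiplicative because the
  degree is additive.\<close>

lemma norm_bound_mult:
  assumes f: "cone_supported f" "norm_bound \<epsilon> f K" and g: "cone_supported g" "norm_bound \<epsilon> g K'"
    and \<epsilon>: "\<epsilon> > 0"
  shows "norm_bound \<epsilon> (series_mult G f g) (K * K')"
  unfolding norm_bound_def
proof (intro allI impI)
  fix P assume P: "finite P" "P \<subseteq> carrier G"
  obtain a where a: "a \<in> carrier G" "series_support f \<subseteq> C #> a" using f by (auto simp: cone_supported_def)
  obtain b where b: "b \<in> carrier G" "series_support g \<subseteq> C #> b" using g by (auto simp: cone_supported_def)
  let ?F = "factorizations G (C #> a) (C #> b)"
  let ?w = "\<lambda>f p. norm (f p :: complex) * \<epsilon> powi deg p"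
  define U where "U = (\<Union>p\<in>P. ?F p)"
  have finF: "finite (?F p)" for p using finite_factorizations a b by blast
  then have finU: "finite U" using P by (simp add: U_def)
  have Ucar: "fst ` U \<subseteq> carrier G" "snd ` U \<subseteq> carrier G"
    using translate_carrier[OF a(1)] translate_carrier[OF b(1)] by (auto simp: U_def factorizations_def)
  have "(\<Sum>p\<in>P. ?w (series_mult G f g) p) \<le> (\<Sum>p\<in>P. \<Sum>(q, r)\<in>?F p. ?w f q * ?w g r)"
  proof (rule sum_mono)
    fix p
    have "?w (series_mult G f g) p = norm (\<Sum>(q, r)\<in>?F p. f q * g r) * \<epsilon> powi deg p"
      using series_mult_eq_sum[OF a(2) b(2) finF] by simp
    also have "\<dots> \<le> (\<Sum>(q, r)\<in>?F p. norm (f q * g r)) * \<epsilon> powi deg p"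
      using norm_sum[of "\<lambda>(q, r). f q * g r" "?F p"] \<epsilon>
      by (intro mult_right_mono) (auto simp: case_prod_unfold)
    also have "\<dots> = (\<Sum>(q, r)\<in>?F p. ?w f q * ?w g r)"
      unfolding sum_distrib_right
    proof (rule sum.cong[OF refl], clarify)
      fix q r assume "(q, r) \<in> ?F p"
      then have "deg p = deg q + deg r"
        using translate_carrier[OF a(1)] translate_carrier[OF b(1)]
        by (auto simp: factorizations_def deg_mult subset_iff)
      then show "norm (f q * g r) * \<epsilon> powi deg p = ?w f q * ?w g r"
        using \<epsilon> by (simp add: power_int_add norm_mult)
    qed
    finally show "?w (series_mult G f g) p \<le> (\<Sum>(q, r)\<in>?F p. ?w f q * ?w g r)" .
  qed
  also have "\<dots> = (\<Sum>(q, r)\<in>U. ?w f q * ?w g r)"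
    unfolding U_def by (rule sum.UNION_disjoint[symmetric]) (use P finF in \<open>auto simp: factorizations_def\<close>)
  \<comment> \<open>The factorizations in \<open>U\<close> are enlarged to the rectangle spanned by
    their two projections, over which the sum splits into a product of two partial sums.\<close>
  also have "\<dots> \<le> (\<Sum>(q, r)\<in>fst ` U \<times> snd ` U. ?w f q * ?w g r)"
    by (rule sum_mono2) (use finU \<epsilon> in \<open>force+\<close>)
  also have "\<dots> = (\<Sum>q\<in>fst ` U. ?w f q) * (\<Sum>r\<in>snd ` U. ?w g r)"
    by (simp add: sum_product sum.cartesian_product)
  also have "\<dots> \<le> K * K'"
    using finU Ucar \<epsilon>
    by (intro mult_mono norm_boundD[OF f(2)] norm_boundD[OF g(2)] norm_bound_nonneg[OF f(2)] sum_nonneg) auto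
  finally show "(\<Sum>p\<in>P. ?w (series_mult G f g) p) \<le> K * K'" .
qed

text \<open>Degrees on the support are integers and positive, so scaling the point by
  \<open>\<delta>\<close> gains at least one factor \<open>\<delta>\<close> in every term. The
  identity has to be excluded because its weight is always 1.\<close>

lemma norm_bound_contract:
  assumes h: "series_support h \<subseteq> C - {\<one>}" "norm_bound \<epsilon> h K" and \<epsilon>: "\<epsilon> > 0" and \<delta>: "0 < \<delta>" "\<delta> \<le> 1"
  shows "norm_bound (\<delta> * \<epsilon>) h (\<delta> * K)"
  unfolding norm_bound_def
proof (intro allI impI)
  fix P assume P: "finite P" "P \<subseteq> carrier G"
  have "(\<Sum>p\<in>P. norm (h p) * (\<delta> * \<epsilon>) powi deg p) \<le> (\<Sum>p\<in>P. \<delta> * (norm (h p) * \<epsilon> powi deg p))"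
  proof (rule sum_mono)
    fix p
    show "norm (h p) * (\<delta> * \<epsilon>) powi deg p \<le> \<delta> * (norm (h p) * \<epsilon> powi deg p)"
    proof (cases "h p = 0")
      case False
      then have "deg p > 0" using h(1) deg_pos by (auto simp: series_support_def)
      then have "\<delta> powi deg p \<le> \<delta> powi 1" using \<delta> by (intro power_int_decreasing) auto
      then have "\<delta> powi deg p * (norm (h p) * \<epsilon> powi deg p) \<le> \<delta> * (norm (h p) * \<epsilon> powi deg p)"
        using \<epsilon> by (intro mult_right_mono) auto
      then show ?thesis by (simp add: power_int_mult_distrib mult_ac)
    qed simp
  qed
  also have "\<dots> \<le> \<delta> * K"
    unfolding sum_distrib_left[symmetric] using norm_boundD[OF h(2) P] \<delta> by (intro mult_left_mono) auto
  finally show "(\<Sum>p\<in>P. norm (h p) * (\<delta> * \<epsilon>) powi deg p) \<le> \<delta> * K" .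
qed

section \<open>The geometric series\<close>

text \<open>The map sending \<open>g\<close> to \<open>1 + h g\<close> is iterated from 0.
  Multiplication by \<open>h\<close> raises the degree, so the iterate \<open>s k\<close> is final
  in all degrees below \<open>k\<close> and the limit exists coefficient by coefficient. The bound 2
  is preserved because 1 + (1/2) 2 = 2.\<close>

lemma ex_geometric_series:
  assumes h: "series_support h \<subseteq> C - {\<one>}" "norm_bound \<epsilon> h (1/2)" and \<epsilon>: "\<epsilon> > 0"
  shows "\<exists>g. series_support g \<subseteq> C \<and> norm_bound \<epsilon> g 2 \<and>
    g = (\<lambda>p. series_monomial \<one> 1 p + series_mult G h g p)"
proof -
  define s where "s k = ((\<lambda>g p. series_monomial \<one> 1 p + series_mult G h g p) ^^ k) (\<lambda>_. 0)" for k
  have s0: "s 0 = (\<lambda>_. 0)" by (simp add: s_def)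
  have sS: "s (Suc k) = (\<lambda>p. series_monomial \<one> 1 p + series_mult G h (s k) p)" for k by (simp add: s_def)
  let ?F = "factorizations G (C #> \<one>) (C #> \<one>)"
  have hC: "series_support h \<subseteq> C #> \<one>" using h by (auto simp: translate_one)
  have cs: "cone_supported f" if "series_support f \<subseteq> C" for f
    using that translate_one unfolding cone_supported_def by auto
  have supp_step: "series_support (\<lambda>p. series_monomial \<one> 1 p + series_mult G h g p) \<subseteq> C"
    if "series_support g \<subseteq> C" for g
  proof -
    have "series_support (series_mult G h g) \<subseteq> C #> (\<one> \<otimes> \<one>)"
      using hC that by (intro series_mult_supported) (auto simp: translate_one)
    then show ?thesis using C_one translate_one by (auto simp: series_support_def series_monomial_def split: if_splits)
  qed
  have sC: "series_support (s k) \<subseteq> C" for k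
    by (induction k) (auto simp: s0 sS series_support_def[of "\<lambda>_. 0"] intro!: supp_step)
  have sb: "norm_bound \<epsilon> (s k) 2" for k
  proof (induction k)
    case 0 then show ?case by (simp add: s0 norm_bound_def)
  next
    case (Suc k)
    have "norm_bound \<epsilon> (series_mult G h (s k)) (1/2 * 2)"
      using cs h sC Suc \<epsilon> by (intro norm_bound_mult) auto
    moreover have "norm_bound \<epsilon> (series_monomial \<one> 1) (norm (1::complex) * \<epsilon> powi deg \<one>)"
      using \<epsilon> by (rule norm_bound_monomial)
    ultimately show ?case unfolding sS using norm_bound_add[OF _ _ \<epsilon>] int_hom_one[OF deg_hom] by fastforce
  qed
  have mult: "series_mult G h g p = (\<Sum>(q, r)\<in>?F p. h q * g r)" if "series_support g \<subseteq> C" for g p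
    using series_mult_eq_sum[OF hC _ finite_factorizations[OF one_closed one_closed]] that translate_one by metis
  \<comment> \<open>The coefficient of \<open>h g\<close> at \<open>p\<close> sees only the
    coefficients of \<open>g\<close> in degrees below \<open>deg p\<close>, since \<open>h\<close>
    has no constant term.\<close>
  have cong: "series_mult G h g p = series_mult G h g' p"
    if g: "series_support g \<subseteq> C" "series_support g' \<subseteq> C"
      and eq: "\<And>r. r \<in> C \<Longrightarrow> deg r < deg p \<Longrightarrow> g r = g' r" for g g' p
    unfolding mult[OF g(1)] mult[OF g(2)]
  proof (rule sum.cong[OF refl], clarify)
    fix q r assume "(q, r) \<in> ?F p"
    then have qr: "q \<in> C" "r \<in> C" "q \<otimes> r = p" by (auto simp: factorizations_def translate_one)
    show "h q * g r = h q * g' r"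
    proof (cases "h q = 0")
      case False
      then have "q \<noteq> \<one>" using h by (auto simp: series_support_def)
      then have "deg q > 0" using deg_pos qr by blast
      moreover have "deg p = deg q + deg r" using qr C_carrier deg_mult by auto
      ultimately show ?thesis using eq qr by auto
    qed simp
  qed
  have zero: "f p = 0" if "series_support f \<subseteq> C" "deg p < 0" for f :: "'a series" and p
    using that deg_nonneg[of p] by (force simp: series_support_def)
  have stable1: "s (Suc k) p = s k p" if "deg p < int k" for k p
    using that
  proof (induction k arbitrary: p)
    case 0 then show ?case using zero[OF sC, of p "Suc 0"] zero[OF sC, of p 0] by simp
  next
    case (Suc k)
    have "series_mult G h (s (Suc k)) p = series_mult G h (s k) p"
      using Suc by (intro cong sC) auto
    then show ?case using sS[of k] sS[of "Suc k"] by simp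
  qed
  have stable: "s m p = s k p" if "deg p < int k" "k \<le> m" for k m p
    using that(2,1) by (induction m rule: dec_induct) (auto simp: stable1)
  \<comment> \<open>The successor makes the index strictly larger than \<open>deg p\<close>, as
    stability requires; negative degrees are truncated to 0, where all coefficients vanish
    anyway.\<close>
  define g where "g p = s (Suc (nat (deg p))) p" for p
  have gs: "g p = s k p" if "deg p < int k" for k p
  proof (cases k)
    case 0
    then show ?thesis using that zero[OF sC, of p] by (simp add: g_def)
  next
    case (Suc k')
    then show ?thesis unfolding g_def by (intro stable[symmetric]) (use that in auto)
  qed
  have gC: "series_support g \<subseteq> C"
    using sC by (auto simp: series_support_def g_def)
  have "norm_bound \<epsilon> g 2"
    unfolding norm_bound_def
  proof (intro allI impI)
    fix P assume P: "finite P" "P \<subseteq> carrier G"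
    \<comment> \<open>One iterate agrees with \<open>g\<close> on all of \<open>P\<close>; the sum
      of the degrees is a crude upper bound for their maximum.\<close>
    obtain k where k: "\<And>p. p \<in> P \<Longrightarrow> deg p < int k"
    proof
      fix p assume "p \<in> P"
      then have "nat (deg p) \<le> (\<Sum>p\<in>P. nat (deg p))" using P by (intro member_le_sum) auto
      then show "deg p < int (Suc (\<Sum>p\<in>P. nat (deg p)))" by linarith
    qed
    have "(\<Sum>p\<in>P. norm (g p) * \<epsilon> powi deg p) = (\<Sum>p\<in>P. norm (s k p) * \<epsilon> powi deg p)"
      by (rule sum.cong) (simp_all add: gs[OF k])
    also have "\<dots> \<le> 2" using norm_boundD[OF sb P] .
    finally show "(\<Sum>p\<in>P. norm (g p) * \<epsilon> powi deg p) \<le> 2" .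
  qed
  moreover have "g p = series_monomial \<one> 1 p + series_mult G h g p" for p
  proof -
    let ?k = "Suc (nat (deg p))"
    have "series_mult G h g p = series_mult G h (s ?k) p"
      by (rule cong[OF gC sC], rule gs) auto
    moreover have "g p = s (Suc ?k) p" by (rule gs) auto
    ultimately show ?thesis using sS[of ?k] by simp
  qed
  ultimately show ?thesis using gC by blast
qed

lemma ex_series_inverse:
  assumes f: "series_support f \<subseteq> C" "f \<one> = 1" "norm_bound \<epsilon> f K" and \<epsilon>: "\<epsilon> > 0"
  shows "\<exists>g \<epsilon>'. \<epsilon>' > 0 \<and> series_support g \<subseteq> C \<and> norm_bound \<epsilon>' g 2 \<and> series_mult G f g = series_monomial \<one> 1"
proof -
  define h where "h p = (if p = \<one> then 0 else - f p)" for p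
  have h1: "series_support h \<subseteq> C - {\<one>}" using f by (auto simp: series_support_def h_def)
  have hK: "norm_bound \<epsilon> h K" by (rule norm_bound_dominated[OF f(3) \<epsilon>]) (simp add: h_def)
  have K: "K \<ge> 0" using norm_bound_nonneg[OF hK] .
  \<comment> \<open>Chosen to give \<open>\<delta> * K \<le> 1/2\<close>; the summand 1 keeps
    \<open>\<delta>\<close> defined and at most 1 also when \<open>K\<close> is 0.\<close>
  define \<delta> where "\<delta> = 1 / (2 * (K + 1))"
  have \<delta>: "0 < \<delta>" "\<delta> \<le> 1" "\<delta> * K \<le> 1/2" using K by (auto simp: \<delta>_def field_simps)
  have "norm_bound (\<delta> * \<epsilon>) h (1/2)"
    using norm_bound_mono[OF norm_bound_contract[OF h1 hK \<epsilon> \<delta>(1,2)] \<delta>(3)] .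
  from ex_geometric_series[OF h1 this] \<delta> \<epsilon> obtain g where
    g: "series_support g \<subseteq> C" "norm_bound (\<delta> * \<epsilon>) g 2"
      "g = (\<lambda>p. series_monomial \<one> 1 p + series_mult G h g p)" by auto
  have cs: "cone_supported f" if "series_support f \<subseteq> C" for f
    using that translate_one unfolding cone_supported_def by auto
  \<comment> \<open>From \<open>f + h = 1\<close> follows \<open>g = f g + h g\<close>; comparison
    with \<open>g = 1 + h g\<close> leaves \<open>f g = 1\<close>.\<close>
  have "(\<lambda>p. f p + h p) = series_monomial \<one> 1" using f by (auto simp: h_def series_monomial_def)
  then have "series_mult G (series_monomial \<one> 1) g = (\<lambda>p. series_mult G f g p + series_mult G h g p)"
    using series_mult_add[OF cs[OF f(1)] cs cs[OF g(1)], of h] h1 by auto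
  moreover have "series_mult G (series_monomial \<one> 1) g = g"
    using series_mult_one g(1) C_carrier by blast
  ultimately have "g p = series_mult G f g p + series_mult G h g p" for p by metis
  moreover have "g p = series_monomial \<one> 1 p + series_mult G h g p" for p using g(3) by metis
  ultimately have "series_mult G f g = series_monomial \<one> 1" by (metis (no_types) add_right_cancel ext)
  then show ?thesis using g \<delta> \<epsilon> by (intro exI[of _ g] exI[of _ "\<delta> * \<epsilon>"]) auto
qed

end

text \<open>Duality lets the product formed from the values \<open>s i p\<close> have the same
  values as \<open>p\<close>. As these separate points, the two agree, which is the spanning half of
  a basis; reading off exponents is the other half.\<close>

lemma (in comm_group) dual_basis:
  assumes s: "\<And>i. i \<in> {1..n} \<Longrightarrow> int_hom G (s i)"
    and y: "y \<in> {1..n} \<rightarrow> carrier G"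
    and dual: "\<And>i j. i \<in> {1..n} \<Longrightarrow> j \<in> {1..n} \<Longrightarrow> s i (y j) = (if i = j then 1 else 0)"
    and inj: "\<And>p q. p \<in> carrier G \<Longrightarrow> q \<in> carrier G \<Longrightarrow> (\<And>i. i \<in> {1..n} \<Longrightarrow> s i p = s i q) \<Longrightarrow> p = q"
  shows dual_basis_coord: "i \<in> {1..n} \<Longrightarrow> s i (\<Otimes>i\<in>{1..n}. y i [^] (k i :: int)) = k i"
    and dual_basis_expand: "p \<in> carrier G \<Longrightarrow> p = (\<Otimes>i\<in>{1..n}. y i [^] s i p)"
    and dual_basis_Z_basis: "Z_basis G n y"
proof -
  let ?P = "\<lambda>k. \<Otimes>i\<in>{1..n}. y i [^] (k i :: int)"
  have Pc: "?P k \<in> carrier G" for k using y by (intro finprod_closed) auto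
  show coord: "s i (?P k) = k i" if "i \<in> {1..n}" for i k
  proof -
    have "s i (?P k) = (\<Sum>j\<in>{1..n}. k j * s i (y j))"
      using s that y by (intro int_hom_finprod_int_pow) auto
    also have "\<dots> = (\<Sum>j\<in>{1..n}. if j = i then k j else 0)"
      by (rule sum.cong) (use dual that in auto)
    finally show ?thesis using that by simp
  qed
  show expand: "p = ?P (\<lambda>i. s i p)" if "p \<in> carrier G" for p
    by (rule inj[OF that Pc]) (rule coord[symmetric])
  have "bij_betw ?P ({1..n} \<rightarrow>\<^sub>E UNIV) (carrier G)"
  proof (rule bij_betw_imageI)
    show "inj_on ?P ({1..n} \<rightarrow>\<^sub>E UNIV)"
    proof (rule inj_onI)
      fix k l assume kl: "k \<in> {1..n} \<rightarrow>\<^sub>E (UNIV :: int set)" "l \<in> {1..n} \<rightarrow>\<^sub>E UNIV" "?P k = ?P l"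
      show "k = l"
      proof (rule PiE_ext[OF kl(1,2)])
        fix i assume "i \<in> {1..n}"
        then show "k i = l i" using coord[of i k] coord[of i l] kl(3) by simp
      qed
    qed
    show "?P ` ({1..n} \<rightarrow>\<^sub>E UNIV) = carrier G"
    proof
      show "carrier G \<subseteq> ?P ` ({1..n} \<rightarrow>\<^sub>E UNIV)"
      proof
        fix p assume p: "p \<in> carrier G"
        \<comment> \<open>The exponent vectors of \<open>Z_basis\<close> are extensional functions,
          hence the restriction.\<close>
        have "?P (restrict (\<lambda>i. s i p) {1..n}) = ?P (\<lambda>i. s i p)"
          using y by (intro finprod_cong') auto
        then show "p \<in> ?P ` ({1..n} \<rightarrow>\<^sub>E UNIV)"
          using expand[OF p] by (intro image_eqI[of _ _ "restrict (\<lambda>i. s i p) {1..n}"]) auto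
      qed
    qed (use Pc in blast)
  qed
  then show "Z_basis G n y" using y by (simp add: Z_basis_def)
qed

section \<open>An exhausting family of simple cones\<close>

context lex_lattice
begin

text \<open>The value at \<open>N\<close> of the polynomial with coefficients \<open>c j p\<close>,
  ..., \<open>c n p\<close>, constant term first. Horner's scheme is the recursion
  \<open>horner_rec\<close>.\<close>

definition horner :: "nat \<Rightarrow> nat \<Rightarrow> 'a \<Rightarrow> int" where
  "horner N j p = (\<Sum>l\<in>{j..n}. int N ^ (l - j) * c l p)"

definition horner_cone :: "nat \<Rightarrow> 'a set" where
  "horner_cone N = {p \<in> carrier G. \<forall>j\<in>{1..n}. horner N j p \<ge> 0}"

definition horner_deg :: "nat \<Rightarrow> 'a \<Rightarrow> int" where
  "horner_deg N p = (\<Sum>j\<in>{1..n}. horner N j p)"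

text \<open>The basis dual to the functionals \<open>horner N j\<close>: their values at
  \<open>e i\<close> are powers of \<open>N\<close> that telescope in
  \<open>e i - N e (i - 1)\<close>, written additively. For \<open>i = 1\<close> there is no lower
  basis vector.\<close>

definition horner_gen :: "nat \<Rightarrow> nat \<Rightarrow> 'a" where
  "horner_gen N i = e i \<otimes> (if i = 1 then \<one> else e (i - 1) [^] (- int N))"

lemma horner_hom: "1 \<le> j \<Longrightarrow> int_hom G (horner N j)"
  unfolding horner_def [abs_def] by (rule int_hom_lincomb) (auto intro: c_hom)

lemma horner_above: "n < j \<Longrightarrow> horner N j p = 0"
  by (simp add: horner_def)

lemma horner_rec:
  assumes "j \<le> n"
  shows "horner N j p = c j p + int N * horner N (Suc j) p"
proof -
  have "horner N j p = c j p + (\<Sum>l\<in>{Suc j..n}. int N ^ (l - j) * c l p)"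
    unfolding horner_def using assms by (simp add: sum.atLeast_Suc_atMost)
  also have "(\<Sum>l\<in>{Suc j..n}. int N ^ (l - j) * c l p) = (\<Sum>l\<in>{Suc j..n}. int N * (int N ^ (l - Suc j) * c l p))"
  proof (rule sum.cong[OF refl])
    fix l assume "l \<in> {Suc j..n}"
    then have "l - j = Suc (l - Suc j)" by auto
    then show "int N ^ (l - j) * c l p = int N * (int N ^ (l - Suc j) * c l p)" by simp
  qed
  finally show ?thesis by (simp add: horner_def sum_distrib_left)
qed

text \<open>The growth from \<open>N\<close> to \<open>N'\<close> splits into a part inherited from
  the next higher coordinate and a part that can be made large through
  \<open>N' - N\<close>.\<close>

lemma horner_change:
  assumes "j \<le> n"
  shows "horner N' j p = horner N j p + int N * (horner N' (Suc j) p - horner N (Suc j) p)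
    + (int N' - int N) * horner N' (Suc j) p"
  using horner_rec[OF assms, of N p] horner_rec[OF assms, of N' p] by (simp add: algebra_simps)

lemma horner_inj:
  assumes "p \<in> carrier G" "q \<in> carrier G" "\<And>i. i \<in> {1..n} \<Longrightarrow> horner N i p = horner N i q"
  shows "p = q"
proof (rule c_inj[OF assms(1,2)])
  fix i assume i: "i \<in> {1..n}"
  have "horner N (Suc i) p = horner N (Suc i) q"
    using assms(3)[of "Suc i"] horner_above[of "Suc i"] i by (cases "i = n") auto
  then show "c i p = c i q" using horner_rec[of i N p] horner_rec[of i N q] assms(3)[OF i] i by auto
qed

lemma horner_e:
  assumes "1 \<le> j" "i \<in> {1..n}"
  shows "horner N j (e i) = (if j \<le> i then int N ^ (i - j) else 0)"
proof -
  have "horner N j (e i) = (\<Sum>l\<in>{j..n}. if l = i then int N ^ (i - j) else 0)"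
    unfolding horner_def by (rule sum.cong) (use assms c_e in auto)
  then show ?thesis using assms by simp
qed

lemma e_pred_closed: "i \<in> {1..n} \<Longrightarrow> i \<noteq> 1 \<Longrightarrow> e (i - 1) \<in> carrier G"
  by (rule e_closed) auto

lemma horner_gen_closed: "horner_gen N \<in> {1..n} \<rightarrow> carrier G"
proof
  fix i assume "i \<in> {1..n}"
  then show "horner_gen N i \<in> carrier G" using e_closed e_pred_closed by (simp add: horner_gen_def)
qed

lemma hom_horner_gen:
  assumes "int_hom G s" "i \<in> {1..n}"
  shows "s (horner_gen N i) = s (e i) - (if i = 1 then 0 else int N * s (e (i - 1)))"
  using assms e_closed[OF assms(2)] e_pred_closed[OF assms(2)]
  by (simp add: horner_gen_def int_hom_mult int_hom_int_pow int_hom_one)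

lemma horner_gen:
  assumes "j \<in> {1..n}" "i \<in> {1..n}"
  shows "horner N j (horner_gen N i) = (if j = i then 1 else 0)"
proof -
  have eq: "horner N j (horner_gen N i) = horner N j (e i) - (if i = 1 then 0 else int N * horner N j (e (i - 1)))"
    using assms by (intro hom_horner_gen horner_hom) auto
  show ?thesis
  proof (cases "i = 1")
    case True then show ?thesis using eq assms by (auto simp: horner_e)
  next
    case False
    then have "i - 1 \<in> {1..n}" using assms by auto
    moreover have "int N ^ (i - j) = int N * int N ^ (i - 1 - j)" if "j \<le> i - 1"
    proof -
      have "i - j = Suc (i - 1 - j)" using that False assms by auto
      then show ?thesis by simp
    qed
    ultimately show ?thesis using eq assms False by (auto simp: horner_e)
  qed
qed

lemma c_horner_gen:
  assumes "i \<in> {1..n}"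
  shows "c i (horner_gen N i) = 1" "l \<in> {i<..n} \<Longrightarrow> c l (horner_gen N i) = 0"
proof -
  have "c l (horner_gen N i) = (if l = i then 1 else 0)" if l: "l \<in> {i..n}" for l
  proof -
    have l1: "l \<in> {1..n}" using l assms by auto
    have "i - 1 \<in> {1..n}" if "i \<noteq> 1" using assms that by auto
    then have "c l (e (i - 1)) = 0" if "i \<noteq> 1" using c_e[OF l1, of "i - 1"] that l by auto
    then show ?thesis using hom_horner_gen[OF c_hom[OF l1] assms, of N] c_e[OF l1 assms] by auto
  qed
  then show "c i (horner_gen N i) = 1" "l \<in> {i<..n} \<Longrightarrow> c l (horner_gen N i) = 0"
    using assms by auto
qed

lemma horner_gen_pos: "i \<in> {1..n} \<Longrightarrow> horner_gen N i \<in> pos G"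
  using pos_lex[of "horner_gen N i"] horner_gen_closed c_horner_gen by (metis Pi_iff zero_less_one)

text \<open>The generator \<open>horner_gen N i\<close> has leading coordinate \<open>i\<close> with
  value 1, so it is positive and lies in \<open>Lhat k\<close> exactly for \<open>i \<le> k\<close>.
  This gives the count required of standard generators.\<close>

lemma horner_cone_simple:
  assumes Lhat: "\<And>k. k \<le> n \<Longrightarrow> Lhat k = {p \<in> carrier G. \<forall>i\<in>{k<..n}. c i p = 0}"
  shows "horner_cone N \<in> simple_cones G n Lhat"
proof -
  have basis: "Z_basis G n (horner_gen N)"
    by (rule dual_basis_Z_basis[OF horner_hom horner_gen_closed horner_gen horner_inj]) auto
  have expand: "p = (\<Otimes>i\<in>{1..n}. horner_gen N i [^] horner N i p)" if "p \<in> carrier G" for p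
    by (rule dual_basis_expand[OF horner_hom horner_gen_closed horner_gen horner_inj]) (use that in auto)
  have coord: "horner N i (\<Otimes>i\<in>{1..n}. horner_gen N i [^] (k i :: int)) = k i" if "i \<in> {1..n}" for i k
    by (rule dual_basis_coord[OF horner_hom horner_gen_closed horner_gen horner_inj]) (use that in auto)
  have "card {i \<in> {1..n}. horner_gen N i \<in> Lhat k \<inter> pos G} = k" if k: "k \<in> {1..n}" for k
  proof -
    have "horner_gen N i \<in> Lhat k \<longleftrightarrow> i \<le> k" if i: "i \<in> {1..n}" for i
    proof -
      have "horner_gen N i \<in> Lhat k \<longleftrightarrow> (\<forall>l\<in>{k<..n}. c l (horner_gen N i) = 0)"
        using Lhat[of k] k funcset_mem[OF horner_gen_closed i] by auto
      also have "\<dots> \<longleftrightarrow> i \<le> k"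
      proof
        assume *: "\<forall>l\<in>{k<..n}. c l (horner_gen N i) = 0"
        show "i \<le> k"
        proof (rule ccontr)
          assume "\<not> i \<le> k"
          then have "c i (horner_gen N i) = 0" using * i by auto
          then show False using c_horner_gen(1)[OF i, of N] by simp
        qed
      next
        assume "i \<le> k"
        then show "\<forall>l\<in>{k<..n}. c l (horner_gen N i) = 0" using c_horner_gen(2)[OF i] by auto
      qed
      finally show ?thesis .
    qed
    then have "{i \<in> {1..n}. horner_gen N i \<in> Lhat k \<inter> pos G} = {1..k}"
      using horner_gen_pos k by auto
    then show ?thesis by simp
  qed
  moreover have "horner_cone N = {(\<Otimes>i\<in>{1..n}. horner_gen N i [^] k i) |k :: nat \<Rightarrow> nat. True}"
  proof (intro equalityI subsetI)
    fix p assume p: "p \<in> horner_cone N"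
    define k where "k i = nat (horner N i p)" for i
    have "p = (\<Otimes>i\<in>{1..n}. horner_gen N i [^] horner N i p)" using expand p by (simp add: horner_cone_def)
    also have "\<dots> = (\<Otimes>i\<in>{1..n}. horner_gen N i [^] k i)"
      using p horner_gen_closed by (intro finprod_cong') (auto simp: k_def horner_cone_def)
    finally show "p \<in> {(\<Otimes>i\<in>{1..n}. horner_gen N i [^] k i) |k :: nat \<Rightarrow> nat. True}" by blast
  next
    fix p assume "p \<in> {(\<Otimes>i\<in>{1..n}. horner_gen N i [^] k i) |k :: nat \<Rightarrow> nat. True}"
    then obtain k :: "nat \<Rightarrow> nat" where "p = (\<Otimes>i\<in>{1..n}. horner_gen N i [^] k i)" by blast
    then have k: "p = (\<Otimes>i\<in>{1..n}. horner_gen N i [^] int (k i))" by (simp add: int_pow_int)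
    then have "p \<in> carrier G" using horner_gen_closed by (auto intro!: finprod_closed)
    then show "p \<in> horner_cone N" using coord[of _ "\<lambda>i. int (k i)"] k by (simp add: horner_cone_def)
  qed
  ultimately show ?thesis unfolding simple_cones_def using basis by blast
qed

lemma horner_cone_graded: "graded_cone G (horner_cone N) (horner_deg N)"
proof
  have h: "int_hom G (horner N j)" if "j \<in> {1..n}" for j using that by (intro horner_hom) auto
  show "horner_cone N \<subseteq> carrier G" by (auto simp: horner_cone_def)
  show "\<one> \<in> horner_cone N" using h by (auto simp: horner_cone_def int_hom_one)
  show "p \<otimes> q \<in> horner_cone N" if "p \<in> horner_cone N" "q \<in> horner_cone N" for p q
    using that h by (auto simp: horner_cone_def int_hom_mult)
  show "int_hom G (horner_deg N)"
    using int_hom_lincomb[of "{1..n}" "horner N" "\<lambda>_. 1"] h by (simp add: horner_deg_def [abs_def])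
  show "horner_deg N p > 0" if p: "p \<in> horner_cone N" "p \<noteq> \<one>" for p
  proof -
    have "p \<in> carrier G" using p by (simp add: horner_cone_def)
    then have "\<exists>j\<in>{1..n}. horner N j p \<noteq> horner N j \<one>"
      using horner_inj[OF _ one_closed, of p N] p(2) by blast
    then obtain j where j: "j \<in> {1..n}" "horner N j p \<noteq> 0" using h by (auto simp: int_hom_one)
    then have "0 < horner N j p" using p by (force simp: horner_cone_def)
    then show ?thesis unfolding horner_deg_def using p j by (intro sum_pos2[of _ j]) (auto simp: horner_cone_def)
  qed
  show "finite {p \<in> horner_cone N. horner_deg N p \<le> d}" for d
  proof (rule inj_on_finite)
    let ?f = "\<lambda>p. restrict (\<lambda>j. horner N j p) {1..n}"
    show "inj_on ?f {p \<in> horner_cone N. horner_deg N p \<le> d}"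
    proof (rule inj_onI)
      fix p q assume "p \<in> {p \<in> horner_cone N. horner_deg N p \<le> d}" "q \<in> {p \<in> horner_cone N. horner_deg N p \<le> d}"
        and eq: "?f p = ?f q"
      moreover have "horner N i p = horner N i q" if "i \<in> {1..n}" for i
        using fun_cong[OF eq, of i] that by simp
      ultimately show "p = q" using horner_inj[of p q N] by (auto simp: horner_cone_def)
    qed
    show "?f ` {p \<in> horner_cone N. horner_deg N p \<le> d} \<subseteq> {1..n} \<rightarrow>\<^sub>E {0..d}"
    proof safe
      fix p j assume p: "p \<in> horner_cone N" "horner_deg N p \<le> d" and j: "j \<in> {1..n}"
      have "horner N j p \<le> horner_deg N p" unfolding horner_deg_def
        using p j by (intro member_le_sum) (auto simp: horner_cone_def)
      then show "?f p j \<in> {0..d}" using p j by (auto simp: horner_cone_def)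
    qed auto
    show "finite ({1..n} \<rightarrow>\<^sub>E {0..d})" by (intro finite_PiE) auto
  qed
  show "\<exists>q\<in>horner_cone N. p \<otimes> q \<in> horner_cone N" if p: "p \<in> carrier G" for p
  proof -
    \<comment> \<open>Each coordinate of \<open>p\<close> is raised by its own absolute value and
      becomes nonnegative.\<close>
    let ?q = "\<Otimes>i\<in>{1..n}. horner_gen N i [^] \<bar>horner N i p\<bar>"
    have q: "horner N i ?q = \<bar>horner N i p\<bar>" if "i \<in> {1..n}" for i
      by (rule dual_basis_coord[OF horner_hom horner_gen_closed horner_gen horner_inj]) (use that in auto)
    have "?q \<in> carrier G" using horner_gen_closed by (intro finprod_closed) auto
    then show ?thesis using q p h by (intro bexI[of _ ?q]) (auto simp: horner_cone_def int_hom_mult)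
  qed
qed

text \<open>Here the order on the group enters: going down from the leading coordinate of \<open>p\<close>, the
  term \<open>(N' - N) * horner N' (Suc j) p\<close> outweighs the lower bound \<open>- m\<close>.\<close>

lemma pos_in_cone:
  assumes p: "p \<in> pos G" and m: "\<And>j. j \<in> {1..n} \<Longrightarrow> horner N j p \<ge> - int m" and N': "N + m + 1 \<le> N'"
  shows "p \<in> horner_cone N'"
proof -
  have pc: "p \<in> carrier G" using p by (rule pos_carrier)
  obtain k where k: "k \<in> {1..n}" "c k p > 0" and z: "\<And>i. i \<in> {k<..n} \<Longrightarrow> c i p = 0"
    using pos_lex[OF pc] p by blast
  have above: "horner M j p = 0" if "k < j" for M j
    unfolding horner_def by (rule sum.neutral) (use z that in auto)
  \<comment> \<open>The claim is 1 rather than 0 as lower bound, so that \<open>N' - N\<close>, at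
    least \<open>m + 1\<close>, is not lost in the product with the next value; the comparison with
    \<open>horner N\<close> keeps the inherited part nonnegative.\<close>
  have "1 \<le> horner N' j p \<and> horner N j p \<le> horner N' j p" if "1 \<le> j" "j \<le> k" for j
    using that(2,1)
  proof (induction j rule: inc_induct)
    case base
    have "k \<le> n" using k by simp
    then show ?case using horner_rec[of k N' p] horner_rec[of k N p] above[of "Suc k"] k by simp
  next
    case (step j)
    have j: "j \<le> n" "j \<in> {1..n}" using step k by auto
    have IH: "1 \<le> horner N' (Suc j) p" "horner N (Suc j) p \<le> horner N' (Suc j) p" using step by auto
    define A where "A = int N * (horner N' (Suc j) p - horner N (Suc j) p)"
    define B where "B = (int N' - int N) * horner N' (Suc j) p"
    have "(int N' - int N) * 1 \<le> B" unfolding B_def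
      using IH N' by (intro mult_left_mono) auto
    moreover have "0 \<le> A" using IH by (simp add: A_def)
    moreover have "horner N' j p = horner N j p + A + B"
      unfolding A_def B_def by (rule horner_change[OF j(1)])
    moreover have "int N + int m + 1 \<le> int N'" using N' by simp
    ultimately have "1 \<le> horner N' j p" "horner N j p \<le> horner N' j p"
      using m[OF j(2)] by simp_all
    then show ?case ..
  qed
  then have "0 \<le> horner N' j p" if "j \<in> {1..n}" for j
    using above[of j N'] that by (cases "j \<le> k") force+
  then show ?thesis using pc by (simp add: horner_cone_def)
qed

text \<open>Stated for all large \<open>M\<close>, so that it can be combined with further
  requirements on the cone.\<close>

lemma pos_translate_eventually_in_cone:
  assumes "a \<in> carrier G" "X \<subseteq> horner_cone N #> a" "X \<subseteq> insert \<one> (pos G)"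
  shows "\<forall>\<^sub>F M in sequentially. X \<subseteq> horner_cone M"
proof -
  \<comment> \<open>The functionals are nonnegative on the cone, so on its translate by
    \<open>a\<close> none falls below \<open>- m\<close>.\<close>
  define m where "m = (\<Sum>j\<in>{1..n}. nat \<bar>horner N j a\<bar>)"
  have "X \<subseteq> horner_cone M" if M: "N + m + 1 \<le> M" for M
  proof
    fix p assume p: "p \<in> X"
    then obtain q where q: "q \<in> horner_cone N" "p = q \<otimes> a" using assms by (auto simp: r_coset_def)
    have low: "horner N j p \<ge> - int m" if j: "j \<in> {1..n}" for j
    proof -
      have "horner N j p = horner N j q + horner N j a"
        using q assms(1) j horner_hom[of j N] by (simp add: int_hom_mult horner_cone_def)
      moreover have "horner N j q \<ge> 0" using q j by (simp add: horner_cone_def)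
      moreover have "nat \<bar>horner N j a\<bar> \<le> m" unfolding m_def using j by (intro member_le_sum) auto
      ultimately show ?thesis by linarith
    qed
    interpret graded_cone G "horner_cone M" "horner_deg M" by (rule horner_cone_graded)
    show "p \<in> horner_cone M"
    proof (cases "p = \<one>")
      case False
      then have "p \<in> pos G" using assms(3) p by blast
      then show ?thesis by (rule pos_in_cone[OF _ low M])
    qed (simp add: C_one)
  qed
  then show ?thesis by (auto simp: eventually_sequentially)
qed

lemma pos_eventually_in_cone:
  assumes "finite X" "X \<subseteq> pos G"
  shows "\<forall>\<^sub>F M in sequentially. X \<subseteq> horner_cone M"
proof -
  have "\<forall>\<^sub>F M in sequentially. x \<in> horner_cone M" if x: "x \<in> X" for x
  proof -
    interpret graded_cone G "horner_cone 0" "horner_deg 0" by (rule horner_cone_graded)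
    have "x \<in> carrier G" using x assms pos_carrier by blast
    moreover have "x \<in> horner_cone 0 #> x" using \<open>x \<in> carrier G\<close> C_one by (force simp: r_coset_def)
    ultimately show ?thesis using pos_translate_eventually_in_cone[of x "{x}" 0] x assms by auto
  qed
  then have "\<forall>\<^sub>F M in sequentially. \<forall>x\<in>X. x \<in> horner_cone M"
    using assms(1) by (rule_tac eventually_ball_finite) auto
  then show ?thesis by eventually_elim auto
qed

text \<open>The lexicographic order is not a well-order on a whole translate of Z^n orthants by
  itself; coordinates are minimized in turn from the top. Once those above \<open>j\<close> are
  fixed, \<open>c j\<close> differs from \<open>horner N j\<close> by a constant, and
  \<open>horner N j\<close> is bounded below on the translate.\<close>

lemma translate_has_least:
  assumes a: "a \<in> carrier G" and X: "X \<subseteq> horner_cone N #> a" "X \<noteq> {}"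
  shows "\<exists>p\<in>X. \<forall>q\<in>X. q \<noteq> p \<longrightarrow> grp_less G p q"
proof -
  interpret graded_cone G "horner_cone N" "horner_deg N" by (rule horner_cone_graded)
  have Xc: "X \<subseteq> carrier G" using X translate_carrier[OF a] by blast
  \<comment> \<open>\<open>p\<close> is at most \<open>q\<close> as far as the coordinates above
    \<open>k\<close> can tell.\<close>
  let ?Q = "\<lambda>k p q. (\<forall>i\<in>{k<..n}. c i q = c i p) \<or>
    (\<exists>l\<in>{k<..n}. c l q > c l p \<and> (\<forall>i\<in>{l<..n}. c i q = c i p))"
  have "\<exists>p\<in>X. \<forall>q\<in>X. ?Q (n - k) p q" if "k \<le> n" for k
    using that
  proof (induction k)
    case 0 then show ?case using X by auto
  next
    case (Suc k)
    then obtain p where p: "p \<in> X" "\<And>q. q \<in> X \<Longrightarrow> ?Q (n - k) p q" by auto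
    define j where "j = n - k"
    have j: "j \<in> {1..n}" "n - Suc k = j - 1" using Suc by (auto simp: j_def)
    define Y where "Y = {q \<in> X. \<forall>i\<in>{j<..n}. c i q = c i p}"
    have "p \<in> Y" using p by (auto simp: Y_def)
    \<comment> \<open>On \<open>X\<close> the difference is nonnegative, as \<open>low\<close>
      shows, so the truncation to natural numbers loses nothing.\<close>
    let ?m = "\<lambda>q. nat (horner N j q - horner N j a)"
    obtain r where r: "r \<in> Y" "\<And>q. q \<in> Y \<Longrightarrow> ?m r \<le> ?m q"
      using arg_min_nat_lemma[of "\<lambda>q. q \<in> Y", OF \<open>p \<in> Y\<close>, of ?m] by blast
    have low: "horner N j q \<ge> horner N j a" if qX: "q \<in> X" for q
    proof -
      obtain b where b: "b \<in> horner_cone N" "q = b \<otimes> a" using subsetD[OF X(1) qX] by (auto simp: r_coset_def)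
      then have "horner N j q = horner N j b + horner N j a"
        using a j horner_hom[of j N] by (simp add: int_hom_mult horner_cone_def)
      then show ?thesis using b j by (simp add: horner_cone_def)
    qed
    have cj: "c j r \<le> c j q" if q: "q \<in> Y" for q
    proof -
      have "horner N (Suc j) q = horner N (Suc j) r"
        unfolding horner_def by (rule sum.cong) (use q r(1) in \<open>auto simp: Y_def\<close>)
      moreover have "horner N j r \<le> horner N j q"
        using r(2)[OF q] low[of r] low[of q] q r(1) by (auto simp: Y_def)
      ultimately show ?thesis using horner_rec[of j N q] horner_rec[of j N r] j by auto
    qed
    have split: "{j - 1<..n} = insert j {j<..n}" using j by auto
    have "?Q (j - 1) r q" if q: "q \<in> X" for q
    proof (cases "q \<in> Y")
      case True
      then have "\<forall>i\<in>{j<..n}. c i q = c i r" using r(1) by (auto simp: Y_def)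
      then show ?thesis using cj[OF True] unfolding split by (cases "c j q = c j r") auto
    next
      case False
      then obtain l where "l \<in> {j<..n}" "c l q > c l p" "\<forall>i\<in>{l<..n}. c i q = c i p"
        using p(2)[OF q] q by (auto simp: Y_def j_def)
      moreover have "c i r = c i p" if "i \<in> {j<..n}" for i using r(1) that by (auto simp: Y_def)
      ultimately show ?thesis unfolding split by (intro disjI2 bexI[of _ l]) auto
    qed
    then show ?case using r(1) j by (auto simp: Y_def)
  qed
  from this[of n] obtain p where p: "p \<in> X" "\<And>q. q \<in> X \<Longrightarrow> ?Q 0 p q" by auto
  have "grp_less G p q" if q: "q \<in> X" "q \<noteq> p" for q
  proof -
    have pc: "p \<in> carrier G" "q \<in> carrier G" using Xc p q by auto
    have "\<exists>i\<in>{1..n}. c i q \<noteq> c i p" using c_inj[of q p] pc q(2) by blast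
    then have "\<not> (\<forall>i\<in>{0<..n}. c i q = c i p)" by force
    then obtain l where l: "l \<in> {0<..n}" "c l q > c l p" "\<forall>i\<in>{l<..n}. c i q = c i p"
      using p(2)[OF q(1)] by blast
    have "c i (q \<otimes> inv p) = c i q - c i p" if "i \<in> {1..n}" for i
      using pc c_hom[OF that] by (simp add: int_hom_mult int_hom_inv)
    then have "q \<otimes> inv p \<in> pos G"
      using l pc pos_lex[of "q \<otimes> inv p"] by (intro iffD2[OF pos_lex]) (auto intro!: bexI[of _ l])
    then show ?thesis by (simp add: grp_less_def)
  qed
  then show ?thesis using p by blast
qed

end

section \<open>The field of Laurent series\<close>

definition is_lowest :: "('a, 'b) ordered_group_scheme \<Rightarrow> 'a series \<Rightarrow> 'a \<Rightarrow> bool" where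
  "is_lowest G f p \<longleftrightarrow> p \<in> series_support f \<and> (\<forall>q\<in>series_support f. q \<noteq> p \<longrightarrow> grp_less G p q)"

context ordered_abelian_group
begin

lemma is_lowest_quotient:
  assumes "is_lowest G f p" "q \<in> series_support f" "series_support f \<subseteq> carrier G"
  shows "q \<otimes> inv p \<in> insert \<one> (pos G)" "q \<otimes> inv p = \<one> \<longleftrightarrow> q = p"
proof -
  have pc: "p \<in> carrier G" "q \<in> carrier G" using assms by (auto simp: is_lowest_def)
  show "q \<otimes> inv p \<in> insert \<one> (pos G)" using assms pc by (cases "q = p") (auto simp: is_lowest_def grp_less_def)
  show "q \<otimes> inv p = \<one> \<longleftrightarrow> q = p" using pc by (metis inv_solve_right l_one one_closed)
qed

lemma lowest_monomial_eq:
  assumes "is_lowest G f p" "series_support f \<subseteq> carrier G"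
  shows "lowest_monomial G f = p"
  unfolding lowest_monomial_def
proof (rule the_equality)
  show "p \<in> series_support f \<and> (\<forall>q\<in>series_support f. q \<noteq> p \<longrightarrow> grp_less G p q)"
    using assms(1) by (simp add: is_lowest_def)
  fix q assume q: "q \<in> series_support f \<and> (\<forall>r\<in>series_support f. r \<noteq> q \<longrightarrow> grp_less G q r)"
  have c: "p \<in> carrier G" "q \<in> carrier G" using assms q by (auto simp: is_lowest_def)
  show "q = p"
  proof (rule ccontr)
    assume "q \<noteq> p"
    then have "q \<otimes> inv p \<in> pos G" "p \<otimes> inv q \<in> pos G"
      using assms q by (auto simp: is_lowest_def grp_less_def)
    moreover have "inv (q \<otimes> inv p) = p \<otimes> inv q" using c by (simp add: inv_mult_group)
    ultimately show False using pos_inv_not_pos by metis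
  qed
qed

text \<open>Any other pair from the supports has a strictly larger product, so
  \<open>p \<otimes> q\<close> has a single factorization and its coefficient
  \<open>f p * g q\<close> cannot cancel.\<close>

lemma is_lowest_mult:
  assumes f: "is_lowest G f p" "series_support f \<subseteq> carrier G"
    and g: "is_lowest G g q" "series_support g \<subseteq> carrier G"
  shows "is_lowest G (series_mult G f g) (p \<otimes> q)"
proof -
  have c: "p \<in> carrier G" "q \<in> carrier G" using assms by (auto simp: is_lowest_def)
  have less: "(r \<otimes> s) \<otimes> inv (p \<otimes> q) \<in> pos G"
    if rs: "r \<in> series_support f" "s \<in> series_support g" "r \<noteq> p \<or> s \<noteq> q" for r s
  proof -
    have rsc: "r \<in> carrier G" "s \<in> carrier G" using rs f g by auto
    have "(r \<otimes> s) \<otimes> inv (p \<otimes> q) = (r \<otimes> inv p) \<otimes> (s \<otimes> inv q)"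
      using c rsc by (simp add: inv_mult_group m_ac)
    moreover have "r \<otimes> inv p \<in> insert \<one> (pos G)" "r \<otimes> inv p = \<one> \<longleftrightarrow> r = p"
      using is_lowest_quotient[OF f(1) rs(1) f(2)] by auto
    moreover have "s \<otimes> inv q \<in> insert \<one> (pos G)" "s \<otimes> inv q = \<one> \<longleftrightarrow> s = q"
      using is_lowest_quotient[OF g(1) rs(2) g(2)] by auto
    ultimately show ?thesis using rs(3) c rsc pos_closed[of "r \<otimes> inv p" "s \<otimes> inv q"] by auto
  qed
  have "{(r, s). r \<in> series_support f \<and> s \<in> series_support g \<and> r \<otimes> s = p \<otimes> q} = {(p, q)}"
  proof (intro equalityI subsetI; clarsimp)
    fix r s assume rs: "r \<in> series_support f" "s \<in> series_support g" "r \<otimes> s = p \<otimes> q"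
    show "r = p \<and> s = q"
    proof (rule ccontr)
      assume "\<not> (r = p \<and> s = q)"
      then have "(p \<otimes> q) \<otimes> inv (p \<otimes> q) \<in> pos G" using less[OF rs(1,2)] rs(3) by auto
      then show False using c one_not_pos by simp
    qed
  next
    show "p \<in> series_support f \<and> q \<in> series_support g" using f g by (simp add: is_lowest_def)
  qed
  then have "series_mult G f g (p \<otimes> q) = f p * g q" by (simp add: series_mult_def)
  then have "p \<otimes> q \<in> series_support (series_mult G f g)"
    using f g by (simp add: is_lowest_def series_support_def)
  moreover have "grp_less G (p \<otimes> q) u" if u: "u \<in> series_support (series_mult G f g)" "u \<noteq> p \<otimes> q" for u
  proof -
    obtain r s where rs: "r \<in> series_support f" "s \<in> series_support g" "u = r \<otimes> s"
      using u(1) by (rule series_mult_support)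
    then show ?thesis using less[OF rs(1,2)] u(2) by (auto simp: grp_less_def)
  qed
  ultimately show ?thesis by (simp add: is_lowest_def)
qed

end

section \<open>Laurent series on a common cone with a common point of convergence\<close>

locale lex_flag = lex_lattice G n c e
  for G :: "('a, 'b) ordered_group_scheme" (structure) and n c e +
  fixes Lhat :: "nat \<Rightarrow> 'a set"
  assumes Lhat_eq: "\<And>k. k \<le> n \<Longrightarrow> Lhat k = {p \<in> carrier G. \<forall>i\<in>{k<..n}. c i p = 0}"
begin

interpretation gc: graded_cone G "horner_cone N" "horner_deg N" for N
  by (rule horner_cone_graded)

text \<open>Every Laurent series lies in this class for all large \<open>N\<close> and, depending on \<open>N\<close>, all small
  \<open>\<epsilon>\<close>; so finitely many of them may be assumed to share \<open>N\<close> and \<open>\<epsilon>\<close>.\<close>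

definition tame :: "nat \<Rightarrow> real \<Rightarrow> 'a series \<Rightarrow> bool" where
  "tame N \<epsilon> f \<longleftrightarrow> \<epsilon> > 0 \<and> gc.cone_supported N f \<and> (\<exists>K. gc.norm_bound N \<epsilon> f K)"

lemma tameD:
  assumes "tame N \<epsilon> f"
  shows "\<epsilon> > 0" "gc.cone_supported N f" "series_support f \<subseteq> carrier G"
  using assms gc.cone_supported_carrier unfolding tame_def by auto

lemma tame_cone: "\<epsilon> > 0 \<Longrightarrow> series_support f \<subseteq> horner_cone N \<Longrightarrow> gc.norm_bound N \<epsilon> f K \<Longrightarrow> tame N \<epsilon> f"
  unfolding tame_def gc.cone_supported_def using gc.translate_one[of N] by auto

lemma tame_zero: "\<epsilon> > 0 \<Longrightarrow> tame N \<epsilon> (\<lambda>_. 0)"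
  by (rule tame_cone[where K = 0]) (auto simp: series_support_def gc.norm_bound_def)

lemma tame_monomial:
  assumes "\<epsilon> > 0" "a \<in> carrier G"
  shows "tame N \<epsilon> (series_monomial a z)"
proof -
  have "\<one> \<otimes> a \<in> horner_cone N #> a" unfolding r_coset_def using gc.C_one by blast
  then have "series_support (series_monomial a z) \<subseteq> horner_cone N #> a"
    using assms(2) by (auto simp: series_support_def series_monomial_def split: if_splits)
  then show ?thesis
    using assms gc.norm_bound_monomial[OF assms(1)] unfolding tame_def gc.cone_supported_def by blast
qed

lemma tame_mult:
  assumes f: "tame N \<epsilon> f" and g: "tame N \<epsilon> g"
  shows "tame N \<epsilon> (series_mult G f g)"
proof -
  obtain a b where a: "a \<in> carrier G" "series_support f \<subseteq> horner_cone N #> a"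
    and b: "b \<in> carrier G" "series_support g \<subseteq> horner_cone N #> b"
    using tameD(2)[OF f] tameD(2)[OF g] unfolding gc.cone_supported_def by blast
  have "gc.cone_supported N (series_mult G f g)"
    unfolding gc.cone_supported_def using gc.series_mult_supported[OF a(1) b(1) a(2) b(2)] a(1) b(1) by blast
  moreover obtain K K' where "gc.norm_bound N \<epsilon> f K" "gc.norm_bound N \<epsilon> g K'"
    using f g unfolding tame_def by blast
  ultimately show ?thesis
    using gc.norm_bound_mult[of N f \<epsilon> K g K'] tameD[OF f] tameD[OF g] unfolding tame_def by blast
qed

lemma tame_add:
  assumes f: "tame N \<epsilon> f" and g: "tame N \<epsilon> g"
  shows "tame N \<epsilon> (\<lambda>p. f p + g p)"
proof -
  obtain a where a: "a \<in> carrier G" "series_support f \<subseteq> horner_cone N #> a" "series_support g \<subseteq> horner_cone N #> a"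
    using gc.cone_supported_add tameD(2)[OF f] tameD(2)[OF g] by blast
  then have "series_support (\<lambda>p. f p + g p) \<subseteq> horner_cone N #> a"
    by (force simp: series_support_def subset_iff)
  then have "gc.cone_supported N (\<lambda>p. f p + g p)" unfolding gc.cone_supported_def using a(1) by blast
  moreover obtain K K' where "gc.norm_bound N \<epsilon> f K" "gc.norm_bound N \<epsilon> g K'"
    using f g unfolding tame_def by blast
  ultimately show ?thesis
    using gc.norm_bound_add[of N \<epsilon> f K g K'] tameD(1)[OF f] unfolding tame_def by blast
qed

lemma tame_uminus: "tame N \<epsilon> f \<Longrightarrow> tame N \<epsilon> (\<lambda>p. - f p)"
  by (simp add: tame_def gc.cone_supported_def series_support_def gc.norm_bound_def)

lemma tame_imp_Laurent:
  assumes f: "tame N \<epsilon> f" and nz: "f \<noteq> (\<lambda>_. 0)"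
  shows "f \<in> nonzero_Laurent_series G n Lhat"
proof -
  have \<epsilon>: "\<epsilon> > 0" using tameD[OF f] by simp
  define t where "t p = complex_of_real (\<epsilon> powi horner_deg N p)" for p
  have "t \<in> torus_points G"
    using \<epsilon> by (auto simp: torus_points_def hom_def complex_units_def t_def gc.deg_mult power_int_add)
  moreover have "series_converges_at G f t"
  proof -
    obtain K where K: "gc.norm_bound N \<epsilon> f K" using f unfolding tame_def by blast
    have "norm (f p * t p) = norm (f p) * \<epsilon> powi horner_deg N p" for p
      using \<epsilon> by (simp add: t_def norm_mult norm_power_int)
    then have "(\<lambda>p. norm (f p * t p)) summable_on carrier G"
      using gc.norm_boundD[OF K] \<epsilon> by (intro nonneg_bdd_above_summable_on bdd_aboveI2[of _ _ K]) auto
    then show ?thesis unfolding series_converges_at_def by (rule abs_summable_summable)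
  qed
  moreover have "\<exists>p0\<in>carrier G. series_support f \<subseteq> horner_cone N #> p0"
    using tameD(2)[OF f] unfolding gc.cone_supported_def .
  ultimately show ?thesis
    unfolding nonzero_Laurent_series_def
    using nz tameD(3)[OF f] horner_cone_simple[OF Lhat_eq] by blast
qed

text \<open>The cone of \<open>f\<close> is generated by finitely many positive elements, which all
  large cones contain. Comparing the weight with the size of \<open>t\<close> on these generators is
  enough, because both are multiplicative.\<close>

lemma Laurent_imp_tame:
  assumes f: "f \<in> nonzero_Laurent_series G n Lhat"
  shows "\<forall>\<^sub>F N in sequentially. \<forall>\<^sub>F \<epsilon> in at_right 0. tame N \<epsilon> f"
proof -
  obtain t C p0 where t: "t \<in> torus_points G" "series_converges_at G f t"
    and C: "C \<in> simple_cones G n Lhat" "p0 \<in> carrier G" "series_support f \<subseteq> C #> p0"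
    using f unfolding nonzero_Laurent_series_def by blast
  obtain x where x: "Z_basis G n x"
      "\<forall>k\<in>{1..n}. card {i \<in> {1..n}. x i \<in> Lhat k \<inter> pos G} = k"
    and Cx: "C = {(\<Otimes>i\<in>{1..n}. x i [^] k i) |k :: nat \<Rightarrow> nat. True}"
    using C(1) unfolding simple_cones_def by blast
  \<comment> \<open>The case \<open>k = n\<close> of the counting condition says that all
    \<open>n\<close> generators are positive.\<close>
  have xpos: "x i \<in> pos G" if i: "i \<in> {1..n}" for i
  proof -
    have "card {i \<in> {1..n}. x i \<in> Lhat n \<inter> pos G} = card {1..n}" using x(2) i by auto
    then have "{i \<in> {1..n}. x i \<in> Lhat n \<inter> pos G} = {1..n}" by (intro card_subset_eq) auto
    then show ?thesis using i by blast
  qed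
  have t_mult: "t (p \<otimes> q) = t p * t q" if "p \<in> carrier G" "q \<in> carrier G" for p q
    using t(1) that by (auto simp: torus_points_def hom_def complex_units_def)
  have t_nz: "t p \<noteq> 0" if "p \<in> carrier G" for p
    using t(1) that by (auto simp: torus_points_def hom_def complex_units_def)
  have t_one: "t \<one> = 1" using t_mult[OF one_closed one_closed] t_nz[OF one_closed] by simp
  have summ: "(\<lambda>p. norm (f p * t p)) summable_on carrier G"
    using t(2) summable_on_iff_abs_summable_on_complex unfolding series_converges_at_def by metis
  have "\<forall>\<^sub>F N in sequentially. x ` {1..n} \<subseteq> horner_cone N"
    by (rule pos_eventually_in_cone) (use xpos in auto)
  then show ?thesis
  proof eventually_elim
    case (elim N)
    \<comment> \<open>The extra 1 bounds \<open>\<epsilon>\<close> by 1, which turns degree at least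
      1 into weight at most \<open>\<epsilon>\<close>, and keeps the minimum defined for
      \<open>n = 0\<close>.\<close>
    define \<mu> where "\<mu> = Min (insert 1 ((\<lambda>i. norm (t (x i))) ` {1..n}))"
    have "0 < \<mu>" unfolding \<mu>_def by (subst Min_gr_iff) (use xpos pos_carrier t_nz in auto)
    then have "\<forall>\<^sub>F \<epsilon> in at_right 0. 0 < \<epsilon> \<and> \<epsilon> < \<mu>"
      using eventually_at_right_real[of 0 \<mu>] by simp
    then show ?case
    proof eventually_elim
      case \<epsilon>: (elim \<epsilon>)
      have \<epsilon>1: "\<epsilon> \<le> 1" and \<epsilon>x: "\<epsilon> \<le> norm (t (x i))" if "i \<in> {1..n}" for i
        using \<epsilon> that Min_le[of "insert 1 ((\<lambda>i. norm (t (x i))) ` {1..n})"] unfolding \<mu>_def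
        by (force intro: order_trans[OF less_imp_le])+
      \<comment> \<open>The part of the cone where the weight is dominated by the given point is a
        submonoid; it contains the generators of \<open>C\<close>, hence \<open>C\<close>.\<close>
      define D where "D = {p \<in> horner_cone N. \<epsilon> powi horner_deg N p \<le> norm (t p)}"
      have D1: "\<one> \<in> D"
        using gc.C_one[of N] t_one int_hom_one[OF gc.deg_hom, of N] by (simp add: D_def)
      have D2: "p \<otimes> q \<in> D" if "p \<in> D" "q \<in> D" for p q
      proof -
        have "p \<in> carrier G" "q \<in> carrier G" using that gc.C_carrier[of N] by (auto simp: D_def)
        then show ?thesis using that \<epsilon> gc.C_mult[of p N q]
          by (auto simp: D_def gc.deg_mult t_mult norm_mult power_int_add intro!: mult_mono)
      qed
      have Dx: "x i \<in> D" if i: "i \<in> {1..n}" for i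
      proof -
        have "x i \<noteq> \<one>" using xpos[OF i] one_not_pos by auto
        moreover have xC: "x i \<in> horner_cone N" using elim i by blast
        ultimately have "1 \<le> horner_deg N (x i)" using gc.deg_pos[of "x i" N] by simp
        then have "\<epsilon> powi horner_deg N (x i) \<le> \<epsilon> powi 1" using \<epsilon> \<epsilon>1[OF i] by (intro power_int_decreasing) auto
        then show ?thesis using \<epsilon>x[OF i] xC by (simp add: D_def)
      qed
      have Dcar: "D \<subseteq> carrier G" using gc.C_carrier by (auto simp: D_def)
      have CD: "C \<subseteq> D"
      proof
        fix p assume "p \<in> C"
        then obtain k :: "nat \<Rightarrow> nat" where p: "p = (\<Otimes>i\<in>{1..n}. x i [^] k i)" using Cx by blast
        show "p \<in> D" unfolding p
          by (rule finprod_mult_closed[OF Dcar D1 D2]) (auto intro: nat_pow_mult_closed[OF D1 D2 Dx])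
      qed
      have "series_support f \<subseteq> horner_cone N #> p0"
        using C(3) CD by (fastforce simp: r_coset_def D_def)
      \<comment> \<open>The constant pays for the shift by \<open>p0\<close>, about whose weight
        nothing is assumed.\<close>
      moreover define B where "B = \<epsilon> powi horner_deg N p0 / norm (t p0)"
      have B: "B \<ge> 0" using \<epsilon> by (simp add: B_def)
      have dom: "norm (f p) * \<epsilon> powi horner_deg N p \<le> B * norm (f p * t p)" for p
      proof (cases "f p = 0")
        case False
        then have "p \<in> C #> p0" using C(3) by (auto simp: series_support_def)
        then obtain q where q: "q \<in> D" "p = q \<otimes> p0" using CD by (auto simp: r_coset_def)
        have qc: "q \<in> carrier G" using q Dcar by auto
        have "\<epsilon> powi horner_deg N p = \<epsilon> powi horner_deg N q * \<epsilon> powi horner_deg N p0"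
          using q qc C(2) \<epsilon> by (simp add: gc.deg_mult power_int_add)
        also have "\<dots> \<le> norm (t q) * \<epsilon> powi horner_deg N p0"
          using q \<epsilon> by (intro mult_right_mono) (auto simp: D_def)
        also have "\<dots> = B * norm (t p)"
          using t_nz[OF C(2)] q t_mult[OF qc C(2)] by (simp add: B_def norm_mult)
        finally have "norm (f p) * \<epsilon> powi horner_deg N p \<le> norm (f p) * (B * norm (t p))"
          by (rule mult_left_mono) simp
        then show ?thesis by (simp add: norm_mult mult_ac)
      qed simp
      have "gc.norm_bound N \<epsilon> f (B * infsum (\<lambda>p. norm (f p * t p)) (carrier G))"
        unfolding gc.norm_bound_def
      proof (intro allI impI)
        fix P assume P: "finite P" "P \<subseteq> carrier G"
        have "(\<Sum>p\<in>P. norm (f p) * \<epsilon> powi horner_deg N p) \<le> (\<Sum>p\<in>P. B * norm (f p * t p))"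
          by (rule sum_mono) (rule dom)
        also have "\<dots> = B * (\<Sum>p\<in>P. norm (f p * t p))" by (simp add: sum_distrib_left)
        also have "\<dots> \<le> B * infsum (\<lambda>p. norm (f p * t p)) (carrier G)"
          using B by (intro mult_left_mono finite_sum_le_infsum[OF summ P]) auto
        finally show "(\<Sum>p\<in>P. norm (f p) * \<epsilon> powi horner_deg N p)
          \<le> B * infsum (\<lambda>p. norm (f p * t p)) (carrier G)" .
      qed
      ultimately show "tame N \<epsilon> f" unfolding tame_def gc.cone_supported_def using \<epsilon> C(2) by blast
    qed
  qed
qed

section \<open>Ring structure, inverses and the valuation\<close>

abbreviation R :: "'a series ring" where "R \<equiv> Laurent_series_ring G n Lhat"

lemma R_simps:
  "\<zero>\<^bsub>R\<^esub> = (\<lambda>_. 0)" "\<one>\<^bsub>R\<^esub> = series_monomial \<one> 1"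
  "(\<otimes>\<^bsub>R\<^esub>) = series_mult G" "(\<oplus>\<^bsub>R\<^esub>) = (\<lambda>f g p. f p + g p)"
  by (simp_all add: Laurent_series_ring_def series_monomial_def [abs_def])

lemma tame_carrier: "tame N \<epsilon> f \<Longrightarrow> f \<in> carrier R"
  using tame_imp_Laurent by (cases "f = (\<lambda>_. 0)") (auto simp: Laurent_series_ring_def)

lemma carrier_tame:
  assumes "f \<in> carrier R"
  shows "\<forall>\<^sub>F N in sequentially. \<forall>\<^sub>F \<epsilon> in at_right 0. tame N \<epsilon> f"
proof (cases "f = (\<lambda>_. 0)")
  case True
  have "\<forall>\<^sub>F \<epsilon>::real in at_right 0. 0 < \<epsilon>" by (rule eventually_at_right_less)
  then have "\<forall>\<^sub>F \<epsilon> in at_right 0. tame N \<epsilon> (\<lambda>_. 0)" for N by eventually_elim (rule tame_zero)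
  then show ?thesis using True by simp
next
  case False
  then show ?thesis using assms Laurent_imp_tame by (simp add: Laurent_series_ring_def)
qed

text \<open>\<open>N\<close> has to be fixed before \<open>\<epsilon>\<close>, since the degree
  depends on it; nested filters allow the conjunction at both levels. Three series are what
  associativity and distributivity involve.\<close>

lemma carrier_tame3:
  assumes "f \<in> carrier R" "g \<in> carrier R" "h \<in> carrier R"
  obtains N \<epsilon> where "tame N \<epsilon> f" "tame N \<epsilon> g" "tame N \<epsilon> h"
proof -
  have "\<forall>\<^sub>F N in sequentially. \<forall>\<^sub>F \<epsilon> in at_right 0. tame N \<epsilon> f \<and> tame N \<epsilon> g \<and> tame N \<epsilon> h"
    using carrier_tame[OF assms(1)] carrier_tame[OF assms(2)] carrier_tame[OF assms(3)]
    by eventually_elim (intro eventually_conj)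
  then obtain N where "\<forall>\<^sub>F \<epsilon> in at_right 0. tame N \<epsilon> f \<and> tame N \<epsilon> g \<and> tame N \<epsilon> h"
    using eventually_happens' sequentially_bot by blast
  then obtain \<epsilon> where "tame N \<epsilon> f \<and> tame N \<epsilon> g \<and> tame N \<epsilon> h"
    using eventually_happens' trivial_limit_at_right_real by blast
  then show ?thesis using that by blast
qed

lemma carrier_support: "f \<in> carrier R \<Longrightarrow> series_support f \<subseteq> carrier G"
  by (meson carrier_tame3 tameD(3))

lemma monomial_carrier: "a \<in> carrier G \<Longrightarrow> series_monomial a z \<in> carrier R"
  using tame_carrier[OF tame_monomial[of 1 a]] by simp

lemma mult_carrier: "f \<in> carrier R \<Longrightarrow> g \<in> carrier R \<Longrightarrow> series_mult G f g \<in> carrier R"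
  by (rule carrier_tame3[of f g g]) (auto intro: tame_carrier tame_mult)

lemma cring_R: "cring R"
proof (rule cringI)
  show "abelian_group R"
  proof (rule abelian_groupI)
    show "f \<oplus>\<^bsub>R\<^esub> g \<in> carrier R" if "f \<in> carrier R" "g \<in> carrier R" for f g
      unfolding R_simps by (rule carrier_tame3[OF that that(2)]) (auto intro: tame_carrier tame_add)
    show "\<zero>\<^bsub>R\<^esub> \<in> carrier R" unfolding R_simps using tame_carrier[OF tame_zero[of 1]] by simp
    show "\<exists>g\<in>carrier R. g \<oplus>\<^bsub>R\<^esub> f = \<zero>\<^bsub>R\<^esub>" if f: "f \<in> carrier R" for f
    proof (rule carrier_tame3[OF f f f])
      fix N \<epsilon> assume "tame N \<epsilon> f"
      then have "(\<lambda>p. - f p) \<in> carrier R" by (intro tame_carrier tame_uminus)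
      then show ?thesis unfolding R_simps by (intro bexI[of _ "\<lambda>p. - f p"]) auto
    qed
  qed (simp_all add: R_simps add_ac)
  show "comm_monoid R"
  proof (rule comm_monoidI)
    show "f \<otimes>\<^bsub>R\<^esub> g \<in> carrier R" if "f \<in> carrier R" "g \<in> carrier R" for f g
      unfolding R_simps using mult_carrier that .
    show "\<one>\<^bsub>R\<^esub> \<in> carrier R" unfolding R_simps by (rule monomial_carrier) simp
    show "(f \<otimes>\<^bsub>R\<^esub> g) \<otimes>\<^bsub>R\<^esub> h = f \<otimes>\<^bsub>R\<^esub> (g \<otimes>\<^bsub>R\<^esub> h)"
      if "f \<in> carrier R" "g \<in> carrier R" "h \<in> carrier R" for f g h
      unfolding R_simps by (rule carrier_tame3[OF that]) (intro gc.series_mult_assoc tameD(2))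
    show "\<one>\<^bsub>R\<^esub> \<otimes>\<^bsub>R\<^esub> f = f" if "f \<in> carrier R" for f
      unfolding R_simps using series_mult_one[OF carrier_support[OF that]] .
    show "f \<otimes>\<^bsub>R\<^esub> g = g \<otimes>\<^bsub>R\<^esub> f" if "f \<in> carrier R" "g \<in> carrier R" for f g
      unfolding R_simps using that by (intro series_mult_commute carrier_support)
  qed
  show "(f \<oplus>\<^bsub>R\<^esub> g) \<otimes>\<^bsub>R\<^esub> h = f \<otimes>\<^bsub>R\<^esub> h \<oplus>\<^bsub>R\<^esub> g \<otimes>\<^bsub>R\<^esub> h"
    if "f \<in> carrier R" "g \<in> carrier R" "h \<in> carrier R" for f g h
    unfolding R_simps by (rule carrier_tame3[OF that]) (intro gc.series_mult_add tameD(2))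
qed

lemma ex_lowest:
  assumes "f \<in> carrier R" "f \<noteq> (\<lambda>_. 0)"
  shows "\<exists>p. is_lowest G f p"
proof -
  obtain N \<epsilon> where "tame N \<epsilon> f" using carrier_tame3[OF assms(1) assms(1) assms(1)] by blast
  then obtain a where "a \<in> carrier G" "series_support f \<subseteq> horner_cone N #> a"
    using tameD(2) unfolding gc.cone_supported_def by blast
  moreover have "series_support f \<noteq> {}" using assms(2) by (auto simp: series_support_def)
  ultimately show ?thesis using translate_has_least unfolding is_lowest_def by blast
qed

text \<open>Dividing by the leading term leaves a series supported in \<open>\<one>\<close> and the positive elements,
  hence in a single cone, where the geometric series applies.\<close>

lemma ex_inverse:
  assumes f: "f \<in> carrier R" "f \<noteq> (\<lambda>_. 0)"
  shows "\<exists>g\<in>carrier R. f \<otimes>\<^bsub>R\<^esub> g = \<one>\<^bsub>R\<^esub>"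
proof -
  interpret R: cring R by (rule cring_R)
  obtain p where p: "is_lowest G f p" using ex_lowest[OF f] by blast
  have supp: "series_support f \<subseteq> carrier G" using f by (intro carrier_support)
  have pc: "p \<in> carrier G" and fp: "f p \<noteq> 0" using p supp by (auto simp: is_lowest_def series_support_def)
  define \<mu> where "\<mu> = series_monomial (inv p) (1 / f p)"
  define f1 where "f1 = series_mult G \<mu> f"
  have \<mu>: "\<mu> \<in> carrier R" unfolding \<mu>_def using pc by (intro monomial_carrier) simp
  have f1: "f1 \<in> carrier R" unfolding f1_def using \<mu> f(1) by (rule mult_carrier)
  have f1_eq: "f1 q = f (p \<otimes> q) / f p" if "q \<in> carrier G" for q
    unfolding f1_def \<mu>_def using series_monomial_mult[OF _ supp that, of "inv p" "1 / f p"] pc by simp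
  have f1_pos: "series_support f1 \<subseteq> insert \<one> (pos G)"
  proof
    fix q assume q: "q \<in> series_support f1"
    then have qc: "q \<in> carrier G" using carrier_support[OF f1] by blast
    then have "p \<otimes> q \<in> series_support f" using q f1_eq[OF qc] by (auto simp: series_support_def)
    from is_lowest_quotient(1)[OF p this supp] show "q \<in> insert \<one> (pos G)"
      using pc qc by (metis inv_solve_right m_closed m_comm)
  qed
  obtain N0 \<epsilon>0 where "tame N0 \<epsilon>0 f1" using carrier_tame3[OF f1 f1 f1] by blast
  then obtain a where "a \<in> carrier G" "series_support f1 \<subseteq> horner_cone N0 #> a"
    using tameD(2) unfolding gc.cone_supported_def by blast
  then have "\<forall>\<^sub>F N in sequentially. series_support f1 \<subseteq> horner_cone N"
    using f1_pos by (rule pos_translate_eventually_in_cone)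
  \<comment> \<open>One \<open>N\<close> must put the support into the cone itself, not only a
    translate, and also admit a point of convergence for the degree of that cone.\<close>
  then have "\<forall>\<^sub>F N in sequentially. series_support f1 \<subseteq> horner_cone N \<and> (\<forall>\<^sub>F \<epsilon> in at_right 0. tame N \<epsilon> f1)"
    using carrier_tame[OF f1] by (rule eventually_conj)
  then obtain N where N: "series_support f1 \<subseteq> horner_cone N" "\<forall>\<^sub>F \<epsilon> in at_right 0. tame N \<epsilon> f1"
    using eventually_happens' sequentially_bot by blast
  then obtain \<epsilon> where \<epsilon>: "tame N \<epsilon> f1"
    using eventually_happens' trivial_limit_at_right_real by blast
  then obtain K where K: "\<epsilon> > 0" "gc.norm_bound N \<epsilon> f1 K" unfolding tame_def by blast
  have "f1 \<one> = 1" using f1_eq[OF one_closed] pc fp by simp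
  from gc.ex_series_inverse[OF N(1) this K(2,1)] obtain g \<epsilon>' where
    g: "\<epsilon>' > 0" "series_support g \<subseteq> horner_cone N" "gc.norm_bound N \<epsilon>' g 2"
      "series_mult G f1 g = series_monomial \<one> 1" by blast
  have gR: "g \<in> carrier R" using tame_carrier[OF tame_cone[OF g(1-3)]] .
  have "f \<otimes>\<^bsub>R\<^esub> (\<mu> \<otimes>\<^bsub>R\<^esub> g) = (\<mu> \<otimes>\<^bsub>R\<^esub> f) \<otimes>\<^bsub>R\<^esub> g" using f(1) \<mu> gR by (simp add: R.m_ac)
  also have "\<dots> = \<one>\<^bsub>R\<^esub>" using g(4) by (simp add: R_simps f1_def)
  finally show ?thesis using \<mu> gR by (intro bexI[of _ "\<mu> \<otimes>\<^bsub>R\<^esub> g"]) auto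
qed

lemma field_R: "field R"
proof -
  interpret R: cring R by (rule cring_R)
  show ?thesis
  proof (rule R.cring_fieldI2)
    show "\<zero>\<^bsub>R\<^esub> \<noteq> \<one>\<^bsub>R\<^esub>" by (auto simp: R_simps series_monomial_def fun_eq_iff)
    show "\<exists>g\<in>carrier R. f \<otimes>\<^bsub>R\<^esub> g = \<one>\<^bsub>R\<^esub>" if "f \<in> carrier R" "f \<noteq> \<zero>\<^bsub>R\<^esub>" for f
      using ex_inverse that by (simp add: R_simps)
  qed
qed

lemma group_hom_lowest_monomial: "group_hom (mult_of R) G (lowest_monomial G)"
proof -
  interpret R: field R by (rule field_R)
  have low: "lowest_monomial G f = p" if "f \<in> carrier R" "is_lowest G f p" for f p
    using lowest_monomial_eq[OF that(2) carrier_support[OF that(1)]] .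
  have "lowest_monomial G \<in> hom (mult_of R) G"
  proof (rule homI)
    fix f assume f: "f \<in> carrier (mult_of R)"
    then have f': "f \<in> carrier R" "f \<noteq> (\<lambda>_. 0)" by (auto simp: R_simps)
    then obtain p where p: "is_lowest G f p" using ex_lowest by blast
    then show "lowest_monomial G f \<in> carrier G"
      using low f' carrier_support[OF f'(1)] by (auto simp: is_lowest_def)
    fix g assume g: "g \<in> carrier (mult_of R)"
    then have g': "g \<in> carrier R" "g \<noteq> (\<lambda>_. 0)" by (auto simp: R_simps)
    then obtain q where q: "is_lowest G g q" using ex_lowest by blast
    have "is_lowest G (series_mult G f g) (p \<otimes> q)"
      using is_lowest_mult[OF p carrier_support q carrier_support] f' g' by blast
    then show "lowest_monomial G (f \<otimes>\<^bsub>mult_of R\<^esub> g) = lowest_monomial G f \<otimes> lowest_monomial G g"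
      using low p q f' g' mult_carrier by (simp add: R_simps)
  qed
  then show ?thesis
    by (intro group_hom.intro group_hom_axioms.intro R.field_mult_group is_group)
qed

end

theorem theorem1p3p1:
  fixes G :: "('a, 'b) ordered_group_scheme"
    and n :: nat
    and Lhat L :: "nat \<Rightarrow> 'a set"
  assumes "flag_of_lattices G n Lhat L"
  shows "field (Laurent_series_ring G n Lhat) \<and>
         group_hom (mult_of (Laurent_series_ring G n Lhat)) G (lowest_monomial G)"
proof -
  interpret flag_of_lattices G n Lhat L by (rule assms)
  obtain c e where ce: "lex_lattice G n c e"
    "\<And>k. k \<le> n \<Longrightarrow> Lhat k = {p \<in> carrier G. \<forall>i\<in>{k<..n}. c i p = 0}"
    using ex_lex_coordinates by blast
  have "lex_flag G n c e Lhat"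
    by (rule lex_flag.intro[OF ce(1)]) (rule lex_flag_axioms.intro, rule ce(2))
  then interpret lex_flag G n c e Lhat .
  show ?thesis using field_R group_hom_lowest_monomial by blast
qed

end
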